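(* Let $F_1,\ldots,F_l$ be vector fields on $\mathbb{R}^n$ that are smooth and bounded together with their derivatives of each order, let $\mathcal{U}=L^2([0,1],\mathbb{R}^l)$, and for $u\in\mathcal{U}$ let $\Phi_u:\mathbb{R}^n\to\mathbb{R}^n$ be the time-one flow of $\dot x=\sum_{i=1}^l F_i(x)u_i$. Let $\Psi:\mathbb{R}^n\to\mathbb{R}^n$ be a diffeomorphism diffeotopic to the identity, let $a:\mathbb{R}^n\to\mathbb{R}$ be a smooth function with $a\ge 0$ and $a(0)=0$, and let $\beta>0$. Let $K\subset\mathbb{R}^n$ be compact and, for every $M\ge1$, let $\alpha^M=(x^{1,M},\ldots,x^{M,M})$ be $M$ pairwise distinct points of $K$, with $\mu_M:=\frac1M\sum_{j=1}^M\delta_{x^{j,M}}$. Assume that there exists a Borel probability measure $\mu$ supported in $K$ such that $\lim_{M\to\infty}\int_{\mathbb{R}^n} f\,d\mu_M=\int_{\mathbb{R}^n} f\,d\mu$ for every bounded continuous $f:\mathbb{R}^n\to\mathbb{R}$. Given $\rho>0$, let $\mathcal{U}_\rho:=\{u\in\mathcal{U}:\|u\|_{L^2}\le\rho\}$ and define, for $u\in\mathcal{U}_\rho$ and $M\ge1$, $$\mathcal{F}^M_\rho(u):=\int_{\mathbb{R}^n}a(\Phi_u(x)-\Psi(x))\,d\mu_M(x)+\frac\beta2\|u\|_{L^2}^2,\qquad \mathcal{F}_\rho(u):=\int_{\mathbb{R}^n}a(\Phi_u(x)-\Psi(x))\,d\mu(x)+\frac\beta2\|u\|_{L^2}^2 .$$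 Then the functionals $(\mathcal{F}^M_\rho)_{M\ge1}$ $\Gamma$-converge to $\mathcal{F}_\rho$ as $M\to\infty$ with respect to the weak topology of $\mathcal{U}$.
   Context: For $u\in\mathcal{U}$ and $x_0\in\mathbb{R}^n$, let $x_{u,x_0}:[0,1]\to\mathbb{R}^n$ be the unique (Carath\'eodory) solution of $\dot x(s)=\sum_{i=1}^l F_i(x(s))u_i(s)$, $x(0)=x_0$; the flow is $\Phi_u(x_0):=x_{u,x_0}(1)$. A diffeomorphism $\Psi$ is diffeotopic to the identity if there is a family of diffeomorphisms $(\Psi_s)_{s\in[0,1]}$ of $\mathbb{R}^n$ depending smoothly on $s$ with $\Psi_0=\mathrm{Id}$, $\Psi_1=\Psi$. $\Gamma$-convergence: $(\mathcal{F}^M_\rho)_{M\ge1}$ $\Gamma$-converges to $\mathcal{F}_\rho:\mathcal{U}_\rho\to\mathbb{R}\cup\{+\infty\}$ with respect to the weak topology of $\mathcal{U}$ as $M\to\infty$ if: (i) for every sequence $(u^M)_{M\ge1}\subset\mathcal{U}_\rho$ with $u^M\rightharpoonup u$ weakly in $L^2$ as $M\to\infty$, one has $\liminf_{M\to\infty}\mathcal{F}^M_\rho(u^M)\ge\mathcal{F}_\rho(u)$; (ii) for every $u\in\mathcal{U}_\rho$ there exists a sequence $(u^M)_{M\ge1}\subset\mathcal{U}_\rho$ with $u^M\rightharpoonup u$ weakly in $L^2$ and $\limsup_{M\to\infty}\mathcal{F}^M_\rho(u^M)\le\mathcal{F}_\rho(u)$. *)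

theory Defs
  imports "HOL-Probability.Probability"
begin

section \<open>Smooth maps, diffeomorphisms and diffeotopies\<close>

primrec iter_dderiv ::
  "'a::euclidean_space list \<Rightarrow> ('a \<Rightarrow> 'b::euclidean_space) \<Rightarrow> 'a \<Rightarrow> 'b" where
  "iter_dderiv [] f = f"
| "iter_dderiv (v # vs) f = (\<lambda>x. frechet_derivative (iter_dderiv vs f) (at x) v)"

text \<open>On an open set, all iterated directional derivatives are differentiable (hence continuous),
  which is smoothness. On a general set such as \<open>[0,1] \<times> \<real>\<^sup>n\<close>, smoothness means having a
  smooth extension to an open neighbourhood.\<close>

definition smooth_on ::
  "'a::euclidean_space set \<Rightarrow> ('a \<Rightarrow> 'b::euclidean_space) \<Rightarrow> bool" where
  "smooth_on S f \<longleftrightarrow>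
     (\<exists>U g. open U \<and> S \<subseteq> U \<and> (\<forall>x\<in>S. g x = f x) \<and>
        (\<forall>vs. \<forall>x\<in>U. iter_dderiv vs g differentiable (at x)))"

abbreviation smooth :: "('a::euclidean_space \<Rightarrow> 'b::euclidean_space) \<Rightarrow> bool" where
  "smooth \<equiv> smooth_on UNIV"

text \<open>In finite dimension, boundedness of the \<open>k\<close>-th derivative tensor amounts to boundedness of
  each of its evaluations at fixed directions. The empty list gives boundedness of \<open>f\<close> itself.\<close>

definition bounded_with_derivs :: "('a::euclidean_space \<Rightarrow> 'b::euclidean_space) \<Rightarrow> bool" where
  "bounded_with_derivs f \<longleftrightarrow> (\<forall>vs. bounded (range (iter_dderiv vs f)))"

definition diffeomorphism :: "('a::euclidean_space \<Rightarrow> 'a) \<Rightarrow> bool" where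
  "diffeomorphism f \<longleftrightarrow> bij f \<and> smooth f \<and> smooth (inv f)"

definition diffeotopic_to_id :: "('a::euclidean_space \<Rightarrow> 'a) \<Rightarrow> bool" where
  "diffeotopic_to_id f \<longleftrightarrow>
     (\<exists>H :: real \<Rightarrow> 'a \<Rightarrow> 'a. (\<forall>s\<in>{0..1}. diffeomorphism (H s)) \<and>
        smooth_on ({0..1} \<times> UNIV) (\<lambda>(s, x). H s x) \<and> H 0 = id \<and> H 1 = f)"


section \<open>The control space \<open>L\<^sup>2([0,1], \<real>\<^sup>l)\<close>\<close>

text \<open>Elements are represented by functions rather than by almost-everywhere classes; values
  outside \<open>[0,1]\<close> are irrelevant.\<close>

definition L2_controls :: "(real \<Rightarrow> real ^ 'l) set" where
  "L2_controls = {u \<in> borel_measurable (lebesgue_on {0..1}).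
     integrable (lebesgue_on {0..1}) (\<lambda>s. (norm (u s))\<^sup>2)}"

definition L2_norm :: "(real \<Rightarrow> real ^ 'l) \<Rightarrow> real" where
  "L2_norm u = sqrt (LINT s|lebesgue_on {0..1}. (norm (u s))\<^sup>2)"

definition L2_ball :: "real \<Rightarrow> (real \<Rightarrow> real ^ 'l) set" where
  "L2_ball \<rho> = {u \<in> L2_controls. L2_norm u \<le> \<rho>}"

text \<open>Continuous linear functionals. The bound by the seminorm \<open>L2_norm\<close> makes them constant on
  almost-everywhere classes.\<close>

definition L2_dual :: "((real \<Rightarrow> real ^ 'l) \<Rightarrow> real) set" where
  "L2_dual = {\<phi>.
     (\<forall>u\<in>L2_controls. \<forall>v\<in>L2_controls. \<phi> (\<lambda>s. u s + v s) = \<phi> u + \<phi> v) \<and>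
     (\<forall>c. \<forall>u\<in>L2_controls. \<phi> (\<lambda>s. c *\<^sub>R u s) = c * \<phi> u) \<and>
     (\<exists>C. \<forall>u\<in>L2_controls. \<bar>\<phi> u\<bar> \<le> C * L2_norm u)}"

definition L2_weakly_converges ::
  "(nat \<Rightarrow> real \<Rightarrow> real ^ 'l) \<Rightarrow> (real \<Rightarrow> real ^ 'l) \<Rightarrow> bool" where
  "L2_weakly_converges us u \<longleftrightarrow>
     u \<in> L2_controls \<and> (\<forall>\<phi>\<in>L2_dual. (\<lambda>M. \<phi> (us M)) \<longlonglongrightarrow> \<phi> u)"

text \<open>Sequences are indexed by \<open>M \<ge> 1\<close>; the value at \<open>M = 0\<close> plays no role. In the first clause the
  limit \<open>u\<close> ranges over the whole space; when \<open>X\<close> is a closed ball it lies in \<open>X\<close> automatically.\<close>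

definition Gamma_converges ::
  "(real \<Rightarrow> real ^ 'l) set \<Rightarrow> (nat \<Rightarrow> (real \<Rightarrow> real ^ 'l) \<Rightarrow> ereal) \<Rightarrow>
   ((real \<Rightarrow> real ^ 'l) \<Rightarrow> ereal) \<Rightarrow> bool" where
  "Gamma_converges X G G_lim \<longleftrightarrow>
     (\<forall>us u. (\<forall>M\<ge>1. us M \<in> X) \<and> L2_weakly_converges us u \<longrightarrow>
        liminf (\<lambda>M. G M (us M)) \<ge> G_lim u) \<and>
     (\<forall>u\<in>X. \<exists>us. (\<forall>M\<ge>1. us M \<in> X) \<and> L2_weakly_converges us u \<and>
        limsup (\<lambda>M. G M (us M)) \<le> G_lim u)"


section \<open>The flow of the linear-control system\<close>

text \<open>The members of the division \<open>d\<close> are compact intervals \<open>[Inf k, Sup k]\<close> with disjoint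
  interiors, so this is the usual definition of an absolutely continuous function.\<close>

definition abs_continuous_on_Icc :: "real \<Rightarrow> real \<Rightarrow> (real \<Rightarrow> 'a::real_normed_vector) \<Rightarrow> bool" where
  "abs_continuous_on_Icc a b f \<longleftrightarrow>
     (\<forall>\<epsilon>>0. \<exists>\<delta>>0. \<forall>d. d division_of \<Union>d \<and> \<Union>d \<subseteq> {a..b} \<and> (\<Sum>k\<in>d. Sup k - Inf k) < \<delta> \<longrightarrow>
        (\<Sum>k\<in>d. norm (f (Sup k) - f (Inf k))) < \<epsilon>)"

definition caratheodory_solution ::
  "('l::finite \<Rightarrow> real ^ 'n \<Rightarrow> real ^ 'n) \<Rightarrow> (real \<Rightarrow> real ^ 'l) \<Rightarrow> real ^ 'n \<Rightarrow>
   (real \<Rightarrow> real ^ 'n) \<Rightarrow> bool" where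
  "caratheodory_solution F u x0 x \<longleftrightarrow>
     abs_continuous_on_Icc 0 1 x \<and> x 0 = x0 \<and>
     (AE s in lebesgue_on {0..1}.
        (x has_vector_derivative (\<Sum>i\<in>UNIV. (u s $ i) *\<^sub>R F i (x s))) (at s within {0..1}))"

text \<open>A trajectory is unique only on \<open>[0,1]\<close>, so the description operator is applied to its
  endpoint rather than to the function.\<close>

definition flow ::
  "('l::finite \<Rightarrow> real ^ 'n \<Rightarrow> real ^ 'n) \<Rightarrow> (real \<Rightarrow> real ^ 'l) \<Rightarrow> real ^ 'n \<Rightarrow> real ^ 'n" where
  "flow F u x0 = (THE y. \<exists>x. caratheodory_solution F u x0 x \<and> x 1 = y)"


section \<open>Empirical measures and the functionals\<close>

definition empirical_measure :: "nat \<Rightarrow> (nat \<Rightarrow> 'a::euclidean_space) \<Rightarrow> 'a measure" where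
  "empirical_measure M x = measure_of UNIV (sets borel)
     (\<lambda>A. ennreal (1 / real M) * (\<Sum>j=1..M. emeasure (return borel (x j)) A))"

definition control_cost ::
  "('l::finite \<Rightarrow> real ^ 'n \<Rightarrow> real ^ 'n) \<Rightarrow> (real ^ 'n \<Rightarrow> real ^ 'n) \<Rightarrow> (real ^ 'n \<Rightarrow> real) \<Rightarrow> real \<Rightarrow>
   (real ^ 'n) measure \<Rightarrow> (real \<Rightarrow> real ^ 'l) \<Rightarrow> real" where
  "control_cost F \<Psi> a \<beta> \<nu> u =
     (\<integral>x. a (flow F u x - \<Psi> x) \<partial>\<nu>) + \<beta> / 2 * (L2_norm u)\<^sup>2"

end

theory Submission
  imports Defs
begin

text \<open>
  The control enters the vector field linearly, so the flow is continuous from the weak topology of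
  the controls to uniform convergence on compact sets. Once this is known, only the convexity of the
  quadratic term and the weak convergence of the empirical measures remain.

  In more detail, let \<open>u\<^sup>M\<close> lie in the ball of radius \<open>\<rho>\<close> and converge weakly to \<open>u\<close>, and let \<open>y\<close> be the
  trajectory of \<open>u\<close> from \<open>x\<close>. For each time \<open>t\<close> the map \<open>v \<mapsto> \<integral>\<^sub>0\<^sup>t \<Sum>\<^sub>i v\<^sub>i F\<^sub>i(y)\<close> is a continuous linear
  functional of \<open>v\<close>, so its values at \<open>u\<^sup>M\<close> converge to its value at \<open>u\<close>. These integrals are
  equicontinuous in \<open>t\<close>, because a bounded set of \<open>L\<^sup>2\<close> is uniformly integrable; the convergence is
  therefore uniform in \<open>t\<close>. This says that \<open>y\<close> solves the integral equation of \<open>u\<^sup>M\<close> up to a uniformly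
  small error, and a Gronwall estimate (\<open>trajectory_stability\<close>) turns the small error into a
  small distance to the trajectory of \<open>u\<^sup>M\<close>. The flows of a bounded set of controls share a Lipschitz constant,
  which upgrades pointwise convergence to \<open>flow_tendsto_uniformly_on_compact\<close>.

  Consequently the endpoint costs integrated against the empirical measures converge along every
  weakly convergent sequence (\<open>endpoint_cost_tendsto\<close>). The liminf inequality follows by bounding
  the norm term from below by its tangent at \<open>u\<close>, which is an affine weakly continuous function
  of the control (\<open>L2_norm_square_minorant\<close>). For the recovery sequence the constant sequence suffices.

  All estimates are made on the integral form of the differential equation. Passing between it and
  Caratheodory solutions requires the two halves of the Lebesgue fundamental theorem of calculus:
  an absolutely continuous function is the integral of its almost everywhere derivative, and an
  indefinite integral is almost everywhere differentiable. Both are proved with gauges. Existence of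
  trajectories is the contraction principle in an exponentially weighted sup norm.
\<close>

section \<open>Absolute continuity and the fundamental theorem of calculus\<close>

lemma sum_length_division_le_measure:
  fixes d :: "real set set"
  assumes "d division_of S" "S \<subseteq> U" "U \<in> lmeasurable"
  shows "(\<Sum>k\<in>d. Sup k - Inf k) \<le> measure lebesgue U"
proof -
  have "compact (\<Union>d)"
    using assms(1) by (intro compact_Union division_ofD(1)[OF assms(1)])
      (metis compact_cbox division_ofD(4))
  then have S: "S \<in> lmeasurable"
    using division_ofD(6)[OF assms(1)] lmeasurable_compact by simp
  have "Sup k - Inf k = integral k (\<lambda>x. 1)" if k: "k \<in> d" for k
  proof -
    obtain u v where "k = cbox u v"
      using division_ofD(4)[OF assms(1) k] by blast
    then show ?thesis using division_ofD(3)[OF assms(1) k] by auto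
  qed
  then have "(\<Sum>k\<in>d. Sup k - Inf k) = (\<Sum>k\<in>d. integral k (\<lambda>x. 1))"
    by simp
  also have "\<dots> = integral S (\<lambda>x. 1)"
  proof (rule integral_combine_division_bottomup[OF assms(1), symmetric])
    fix k assume "k \<in> d"
    then obtain u v where "k = cbox u v"
      using division_ofD(4)[OF assms(1)] by blast
    then show "(\<lambda>x. 1::real) integrable_on k" by auto
  qed
  also have "\<dots> = measure lebesgue S"
    using lmeasure_integral[OF S] by simp
  also have "\<dots> \<le> measure lebesgue U"
    by (rule measure_mono_fmeasurable[OF assms(2) fmeasurableD[OF S] assms(3)])
  finally show ?thesis .
qed

text \<open>
  Away from \<open>N\<close> a fine tagged interval satisfies the straddle estimate, so its contribution differs
  from the increment of \<open>f\<close> by at most a small multiple of its length. The intervals tagged in \<open>N\<close> are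
  forced by the gauge into an open set of small measure, where absolute continuity makes the total
  increment small.
\<close>

lemma abs_continuous_FTC:
  fixes f :: "real \<Rightarrow> 'a::banach"
  assumes "a \<le> b" and ac: "abs_continuous_on_Icc a b f" and N: "negligible N"
    and der: "\<And>t. t \<in> {a..b} - N \<Longrightarrow> (f has_vector_derivative g t) (at t within {a..b})"
  shows "(g has_integral (f b - f a)) {a..b}"
proof -
  \<comment> \<open>A null set of changes does not affect the integral; with the value 0 the intervals tagged in \<open>N\<close> contribute only increments of \<open>f\<close>.\<close>
  define h where "h t = (if t \<in> N then 0 else g t)" for t
  have "(h has_integral (f b - f a)) {a..b}"
    unfolding has_integral_real
  proof (intro allI impI)
    fix e :: real assume "e > 0"
    define e1 where "e1 = e / (2 * (b - a + 1))"
    have "e1 > 0" using \<open>e > 0\<close> \<open>a \<le> b\<close> by (simp add: e1_def)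
    have "e / 2 > 0" using \<open>e > 0\<close> by simp
    then obtain \<delta> where "\<delta> > 0" and \<delta>: "\<And>d. \<lbrakk>d division_of \<Union>d; \<Union>d \<subseteq> {a..b}; (\<Sum>k\<in>d. Sup k - Inf k) < \<delta>\<rbrakk>
        \<Longrightarrow> (\<Sum>k\<in>d. norm (f (Sup k) - f (Inf k))) < e / 2"
      using ac[unfolded abs_continuous_on_Icc_def, rule_format, of "e / 2"] by blast
    obtain U where U: "open U" "N \<subseteq> U" "U - N \<in> lmeasurable" "emeasure lebesgue (U - N) < ennreal \<delta>"
      using sets_lebesgue_outer_open[OF negligible_imp_sets[OF N] \<open>\<delta> > 0\<close>] by blast
    have Ueq: "U = (U - N) \<union> N" using U by blast
    have Um: "U \<in> lmeasurable"
      by (subst Ueq) (rule fmeasurable.Un[OF U(3) negligible_imp_measurable[OF N]])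
    have "measure lebesgue U = measure lebesgue (U - N)"
      by (subst Ueq, rule measure_Un_null_set)
        (use N U(3) in \<open>auto simp: negligible_iff_null_sets fmeasurableD\<close>)
    also have "\<dots> < \<delta>"
      using U(3,4) \<open>\<delta> > 0\<close> by (simp add: emeasure_eq_measure2 fmeasurableD2 ennreal_less_iff)
    finally have mU: "measure lebesgue U < \<delta>" .
    have "\<exists>d>0. t \<in> {a..b} - N \<longrightarrow> (\<forall>y\<in>{a..b}. norm (y - t) < d \<longrightarrow>
        norm (f y - f t - (y - t) *\<^sub>R g t) \<le> e1 * norm (y - t))" for t
    proof (cases "t \<in> {a..b} - N")
      case True
      then show ?thesis
        using der[OF True] \<open>e1 > 0\<close> unfolding has_vector_derivative_def has_derivative_within_alt
        by blast
    qed (auto intro: exI[of _ 1])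
    then obtain dd where dd0: "\<And>t. dd t > 0"
      and dd: "\<And>t y. \<lbrakk>t \<in> {a..b} - N; y \<in> {a..b}; norm (y - t) < dd t\<rbrakk> \<Longrightarrow>
        norm (f y - f t - (y - t) *\<^sub>R g t) \<le> e1 * norm (y - t)"
      using choice[of "\<lambda>t d. d > 0 \<and> (t \<in> {a..b} - N \<longrightarrow> (\<forall>y\<in>{a..b}. norm (y - t) < d \<longrightarrow>
        norm (f y - f t - (y - t) *\<^sub>R g t) \<le> e1 * norm (y - t)))"] by blast
    define \<gamma> where "\<gamma> t = (if t \<in> N then U else ball t (dd t))" for t
    have "gauge \<gamma>"
      using U dd0 by (auto simp: gauge_def \<gamma>_def)
    moreover have "norm ((\<Sum>(x,k)\<in>D. measure lborel k *\<^sub>R h x) - (f b - f a)) < e"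
      if D: "D tagged_division_of {a..b}" "\<gamma> fine D" for D
    proof -
      have finD: "finite D" using D(1) by blast
      \<comment> \<open>The value 0 on the empty set is what reindexing a tagged division by its intervals requires.\<close>
      define q where "q K = (if K = {} then 0 else norm (f (Sup K) - f (Inf K)))" for K :: "real set"
      define DN where "DN = {xk\<in>D. fst xk \<in> N}"
      have K: "\<exists>u v. K = {u..v} \<and> u \<le> x \<and> x \<le> v \<and> {u..v} \<subseteq> {a..b} \<and> {u..v} \<subseteq> \<gamma> x" if xk: "(x,K) \<in> D" for x K
      proof -
        obtain u v where uv: "K = {u..v}"
          using tagged_division_ofD(4)[OF D(1) xk] by auto
        have "x \<in> K" "K \<subseteq> {a..b}" "K \<subseteq> \<gamma> x"
          using tagged_division_ofD(2,3)[OF D(1) xk] D(2) xk by (auto simp: fine_def)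
        then show ?thesis unfolding uv by (intro exI[of _ u] exI[of _ v]) simp
      qed
      have est: "norm (measure lborel k *\<^sub>R h x - (f (Sup k) - f (Inf k)))
          \<le> e1 * (Sup k - Inf k) + (if x \<in> N then q k else 0)" if xk: "(x,k) \<in> D" for x k
      proof -
        obtain u v where uv: "k = {u..v}" "u \<le> x" "x \<le> v" "{u..v} \<subseteq> {a..b}" "{u..v} \<subseteq> \<gamma> x"
          using K[OF xk] by blast
        show ?thesis
        proof (cases "x \<in> N")
          case True
          then show ?thesis
            using uv \<open>e1 > 0\<close> norm_minus_commute[of "f u" "f v"] by (simp add: h_def q_def)
        next
          case False
          have xv: "u \<in> ball x (dd x)" "v \<in> ball x (dd x)"
            using uv False by (auto simp: \<gamma>_def subset_iff)
          have 1: "norm (f v - f x - (v - x) *\<^sub>R g x) \<le> e1 * norm (v - x)"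
            using uv False xv by (intro dd) (auto simp: dist_real_def)
          have 2: "norm (f u - f x - (u - x) *\<^sub>R g x) \<le> e1 * norm (u - x)"
            using uv False xv by (intro dd) (auto simp: dist_real_def)
          have "measure lborel k *\<^sub>R h x - (f (Sup k) - f (Inf k))
              = (f u - f x - (u - x) *\<^sub>R g x) - (f v - f x - (v - x) *\<^sub>R g x)"
            using uv False by (simp add: h_def algebra_simps)
          also have "norm \<dots> \<le> e1 * norm (u - x) + e1 * norm (v - x)"
            by (rule order_trans[OF norm_triangle_ineq4 add_mono[OF 2 1]])
          also have "\<dots> = e1 * (v - u)"
            using uv by (simp add: algebra_simps)
          finally show ?thesis using uv False by simp
        qed
      qed
      have sums: "(\<Sum>(x,k)\<in>D. f (Sup k) - f (Inf k)) = f b - f a" "(\<Sum>(x,k)\<in>D. Sup k - Inf k) = b - a"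
        using additive_tagged_division_1[OF \<open>a \<le> b\<close> D(1), of f]
          additive_tagged_division_1[OF \<open>a \<le> b\<close> D(1), of "\<lambda>x. x"] by auto
      have "D tagged_partial_division_of {a..b}" using D(1) by (simp add: tagged_division_of_def)
      then have DNp: "DN tagged_partial_division_of {a..b}"
        by (rule tagged_partial_division_subset) (auto simp: DN_def)
      then have DNt: "DN tagged_division_of \<Union>(snd ` DN)"
        by (rule tagged_partial_division_of_Union_self)
      have DNd: "snd ` DN division_of \<Union>(snd ` DN)"
        by (rule division_of_tagged_division[OF DNt])
      have "snd xk \<subseteq> {a..b} \<and> snd xk \<subseteq> U" if "xk \<in> DN" for xk
        using that K[of "fst xk" "snd xk"] by (auto simp: DN_def \<gamma>_def)
      then have sub: "\<Union>(snd ` DN) \<subseteq> {a..b}" "\<Union>(snd ` DN) \<subseteq> U"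
        by blast+
      have "(\<Sum>(x,k)\<in>D. if x \<in> N then q k else 0) = (\<Sum>(x,k)\<in>DN. q k)"
        unfolding DN_def by (subst sum.inter_filter[OF finD]) (auto intro!: sum.cong)
      also have "\<dots> = (\<Sum>k\<in>snd ` DN. q k)"
        by (rule sum.over_tagged_division_lemma[OF DNt]) (auto simp: q_def)
      also have "\<dots> = (\<Sum>k\<in>snd ` DN. norm (f (Sup k) - f (Inf k)))"
        by (intro sum.cong) (simp_all add: q_def division_ofD(3)[OF DNd])
      also have "\<dots> < e / 2"
        using sum_length_division_le_measure[OF DNd sub(2) Um] mU
        by (intro \<delta>[OF DNd sub(1)]) simp
      finally have half: "(\<Sum>(x,k)\<in>D. if x \<in> N then q k else 0) < e / 2" .
      have "(\<Sum>(x,k)\<in>D. measure lborel k *\<^sub>R h x) - (f b - f a)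
          = (\<Sum>(x,k)\<in>D. measure lborel k *\<^sub>R h x - (f (Sup k) - f (Inf k)))"
        unfolding sums(1)[symmetric] by (simp add: sum_subtractf case_prod_unfold)
      also have "norm \<dots> \<le> (\<Sum>(x,k)\<in>D. e1 * (Sup k - Inf k) + (if x \<in> N then q k else 0))"
        using est by (intro sum_norm_le) auto
      also have "\<dots> = e1 * (b - a) + (\<Sum>(x,k)\<in>D. if x \<in> N then q k else 0)"
        unfolding sums(2)[symmetric] by (simp add: sum.distrib sum_distrib_left case_prod_unfold)
      also have "e1 * (b - a) \<le> e / 2"
        using \<open>a \<le> b\<close> \<open>e > 0\<close> by (simp add: e1_def field_simps)
      finally show ?thesis using half by simp
    qed
    ultimately show "\<exists>\<gamma>. gauge \<gamma> \<and> (\<forall>D. D tagged_division_of {a..b} \<and> \<gamma> fine D \<longrightarrow>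
        norm ((\<Sum>(x,k)\<in>D. measure lborel k *\<^sub>R h x) - (f b - f a)) < e)"
      by (intro exI[of _ \<gamma>]) simp
  qed
  then show ?thesis
    by (rule has_integral_spike[OF N, rotated]) (auto simp: h_def)
qed

text \<open>
  At a bad point there are arbitrarily short intervals on which \<open>(s - t) f(t)\<close> misses the integral by
  more than \<open>\<eta>\<close> times the length. These intervals form a Vitali cover. A disjoint subfamily covering
  almost all bad points is a fine tagged partial division, so the Henstock lemma bounds its total error by
  \<open>e \<eta>\<close> and hence its total length by \<open>e\<close>.
\<close>

lemma negligible_Henstock_bad_points:
  fixes f :: "real \<Rightarrow> 'a::euclidean_space"
  assumes f: "f integrable_on {a..b}" and "\<eta> > 0"
  shows "negligible {t\<in>{a..b}. \<forall>d>0. \<exists>s\<in>{a..b}. norm (s - t) < d \<and>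
     \<not> norm (integral {a..s} f - integral {a..t} f - (s - t) *\<^sub>R f t) \<le> \<eta> * norm (s - t)}" (is "negligible ?E")
  unfolding negligible_outer_le
proof (intro allI impI)
  fix e :: real assume "e > 0"
  let ?bad = "\<lambda>t s. \<not> norm (integral {a..s} f - integral {a..t} f - (s - t) *\<^sub>R f t) \<le> \<eta> * norm (s - t)"
  have "e * \<eta> > 0" using \<open>e > 0\<close> \<open>\<eta> > 0\<close> by simp
  then obtain \<gamma> where "gauge \<gamma>" and \<gamma>: "\<And>p. \<lbrakk>p tagged_partial_division_of (cbox a b); \<gamma> fine p\<rbrakk> \<Longrightarrow>
      (\<Sum>(x,k)\<in>p. norm (measure lborel k *\<^sub>R f x - integral k f)) < e * \<eta>"
    using Henstock_lemma[of f a b "e * \<eta>"] f by auto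
  \<comment> \<open>The interval between \<open>t\<close> and \<open>s\<close>, written as a ball for the covering theorem.\<close>
  define c where "c = (\<lambda>(t::real, s::real). (t + s) / 2)"
  define r where "r = (\<lambda>(t::real, s::real). \<bar>s - t\<bar> / 2)"
  define I where "I = (\<lambda>i. cball (c i) (r i))"
  have I: "I (t, s) = {min t s..max t s}" for t s
    unfolding I_def c_def r_def cball_eq_atLeastAtMost by (auto simp: min_def max_def field_simps)
  define Q where "Q = {(t, s). t \<in> ?E \<and> s \<in> {a..b} \<and> s \<noteq> t \<and> I (t, s) \<subseteq> \<gamma> t \<and> ?bad t s}"
  have cov: "\<exists>i. i \<in> Q \<and> t \<in> cball (c i) (r i) \<and> r i < d" if tE: "t \<in> ?E" and "d > 0" for t d
  proof -
    obtain k where "k > 0" and k: "ball t k \<subseteq> \<gamma> t"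
      using \<open>gauge \<gamma>\<close> unfolding gauge_def by (metis open_contains_ball)
    have "min d k > 0" using \<open>k > 0\<close> \<open>d > 0\<close> by simp
    then obtain s where s: "s \<in> {a..b}" "norm (s - t) < min d k" "?bad t s"
      using tE by blast
    then have "s \<noteq> t" by auto
    moreover have "I (t, s) \<subseteq> \<gamma> t"
    proof
      fix y assume "y \<in> I (t, s)"
      then have "y \<in> ball t k"
        using s(2) unfolding I by (auto simp: dist_real_def min_def max_def split: if_splits)
      then show "y \<in> \<gamma> t" using k by blast
    qed
    ultimately have "(t, s) \<in> Q" using s tE by (simp add: Q_def)
    moreover have "t \<in> I (t, s)" "r (t, s) < d"
      using s(2) unfolding I by (auto simp: r_def)
    ultimately show ?thesis unfolding I_def by blast
  qed
  have rpos: "0 < r i" if "i \<in> Q" for i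
    using that by (auto simp: Q_def r_def)
  obtain C where "countable C" "C \<subseteq> Q"
     "pairwise (\<lambda>i j. disjnt (cball (c i) (r i)) (cball (c j) (r j))) C"
     "negligible (?E - (\<Union>i \<in> C. cball (c i) (r i)))"
    using Vitali_covering_theorem_cballs[of Q r ?E c, OF rpos cov] .
  then have C: "countable C" "C \<subseteq> Q" "pairwise (\<lambda>i j. disjnt (I i) (I j)) C"
     "negligible (?E - (\<Union>i \<in> C. I i))"
    unfolding I_def by auto
  have fin: "measure lebesgue (\<Union>i\<in>D. I i) \<le> e" if D: "D \<subseteq> C" "finite D" for D
  proof -
    have DQ: "D \<subseteq> Q" using C D by blast
    have ne: "I i \<noteq> {}" if "i \<in> D" for i
      using that DQ rpos[of i] by (auto simp: I_def)
    have dis: "disjnt (I i) (I j)" if "i \<in> D" "j \<in> D" "i \<noteq> j" for i j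
      using C(3) D(1) that by (auto simp: pairwise_def)
    define p where "p = (\<lambda>i. (fst i, I i)) ` D"
    have inj: "inj_on (\<lambda>i. (fst i, I i)) D"
      using ne dis by (auto simp: inj_on_def disjnt_def) (metis inf.idem prod.collapse)
    have sub: "I i \<subseteq> {a..b}" if "i \<in> D" for i
      using that DQ by (cases i) (auto simp: Q_def I)
    have "p tagged_partial_division_of (cbox a b)"
      unfolding tagged_partial_division_of_def
    proof (intro conjI allI impI)
      show "finite p" using D by (simp add: p_def)
    next
      fix x K assume "(x, K) \<in> p"
      then obtain i where i: "i \<in> D" "x = fst i" "K = I i" by (auto simp: p_def)
      show "x \<in> K" "K \<subseteq> cbox a b" "\<exists>u v. K = cbox u v"
        using i sub by (cases i; auto simp: I)+
    next
      fix x1 K1 x2 K2 assume *: "(x1, K1) \<in> p \<and> (x2, K2) \<in> p \<and> (x1, K1) \<noteq> (x2, K2)"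
      then obtain i j where "i \<in> D" "j \<in> D" "K1 = I i" "K2 = I j" "x1 = fst i" "x2 = fst j"
        by (auto simp: p_def)
      with * dis[of i j] have "disjnt K1 K2" by auto
      then show "interior K1 \<inter> interior K2 = {}"
        by (metis disjnt_def interior_Int interior_empty)
    qed
    moreover have "\<gamma> fine p"
      using DQ by (force simp: fine_def p_def Q_def)
    ultimately have H: "(\<Sum>(x,k)\<in>p. norm (measure lborel k *\<^sub>R f x - integral k f)) < e * \<eta>"
      by (rule \<gamma>)
    have low: "\<eta> * measure lborel (I i) \<le> norm (measure lborel (I i) *\<^sub>R f (fst i) - integral (I i) f)" if "i \<in> D" for i
    proof -
      obtain t s where i: "i = (t, s)" by (cases i)
      with that DQ have *: "t \<in> {a..b}" "s \<in> {a..b}" "?bad t s" by (auto simp: Q_def)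
      have comb: "integral {a..u} f + integral {u..v} f = integral {a..v} f" if "a \<le> u" "u \<le> v" "v \<le> b" for u v
        using that f by (intro Henstock_Kurzweil_Integration.integral_combine)
          (auto intro: integrable_subinterval_real)
      show ?thesis
      proof (cases "t \<le> s")
        case True
        then have "integral {a..s} f - integral {a..t} f = integral {t..s} f"
          using comb[of t s] * by (simp add: algebra_simps)
        then show ?thesis using * True i by (simp add: I norm_minus_commute)
      next
        case False
        then have "integral {a..t} f - integral {a..s} f = integral {s..t} f"
          using comb[of s t] * by (simp add: algebra_simps)
        then have "integral {a..s} f - integral {a..t} f - (s - t) *\<^sub>R f t = (t - s) *\<^sub>R f t - integral {s..t} f"
          by (simp add: algebra_simps)
        then show ?thesis using * False i by (simp add: I)
      qed
    qed
    have "measure lebesgue (\<Union>i\<in>D. I i) \<le> (\<Sum>i\<in>D. measure lborel (I i))"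
      using measure_UNION_le[OF D(2), of I lebesgue] by (simp add: I_def)
    then have "\<eta> * measure lebesgue (\<Union>i\<in>D. I i) \<le> \<eta> * (\<Sum>i\<in>D. measure lborel (I i))"
      using \<open>\<eta> > 0\<close> by simp
    also have "\<dots> \<le> (\<Sum>i\<in>D. norm (measure lborel (I i) *\<^sub>R f (fst i) - integral (I i) f))"
      unfolding sum_distrib_left by (intro sum_mono low)
    also have "\<dots> = (\<Sum>(x,k)\<in>p. norm (measure lborel k *\<^sub>R f x - integral k f))"
      unfolding p_def by (subst sum.reindex[OF inj]) simp
    finally have "\<eta> * measure lebesgue (\<Union>i\<in>D. I i) < e * \<eta>"
      using H \<open>\<eta> > 0\<close> by linarith
    then have "\<eta> * measure lebesgue (\<Union>i\<in>D. I i) < \<eta> * e"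
      by (simp only: mult.commute)
    then show ?thesis using \<open>\<eta> > 0\<close> by simp
  qed
  have Im: "I i \<in> lmeasurable" for i by (simp add: I_def)
  let ?T = "(\<Union>i\<in>C. I i) \<union> (?E - (\<Union>i \<in> C. I i))"
  have U: "(\<Union>i\<in>C. I i) \<in> lmeasurable" "measure lebesgue (\<Union>i\<in>C. I i) \<le> e"
    using fmeasurable_UN_bound[OF C(1) Im fin] measure_UN_bound[OF C(1) Im fin] by auto
  show "\<exists>T. ?E \<subseteq> T \<and> T \<in> lmeasurable \<and> measure lebesgue T \<le> e"
  proof (intro exI conjI)
    have "A \<subseteq> B \<union> (A - B)" for A B :: "real set" by blast
    then show "?E \<subseteq> ?T" .
    show "?T \<in> lmeasurable"
      by (rule fmeasurable.Un[OF U(1) negligible_imp_measurable[OF C(4)]])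
    have "measure lebesgue ?T = measure lebesgue (\<Union>i\<in>C. I i)"
      by (rule measure_Un_null_set[OF fmeasurableD[OF U(1)] C(4)[unfolded negligible_iff_null_sets]])
    then show "measure lebesgue ?T \<le> e" using U(2) by (simp only:)
  qed
qed

theorem indefinite_integral_has_vector_derivative_AE:
  fixes f :: "real \<Rightarrow> 'a::euclidean_space"
  assumes f: "f integrable_on {a..b}"
  obtains N where "negligible N"
    "\<And>t. t \<in> {a..b} - N \<Longrightarrow> ((\<lambda>t. integral {a..t} f) has_vector_derivative f t) (at t within {a..b})"
proof
  define E where "E \<eta> = {t\<in>{a..b}. \<forall>d>0. \<exists>s\<in>{a..b}. norm (s - t) < d \<and>
     \<not> norm (integral {a..s} f - integral {a..t} f - (s - t) *\<^sub>R f t) \<le> \<eta> * norm (s - t)}" for \<eta> :: real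
  \<comment> \<open>Countably many tolerances suffice.\<close>
  define N where "N = (\<Union>n. E (1 / real (Suc n)))"
  have "negligible (E (1 / real (Suc n)))" for n
    unfolding E_def by (rule negligible_Henstock_bad_points[OF f]) simp
  then show "negligible N"
    unfolding N_def by (intro negligible_countable_Union) auto
  fix t assume t: "t \<in> {a..b} - N"
  show "((\<lambda>t. integral {a..t} f) has_vector_derivative f t) (at t within {a..b})"
    unfolding has_vector_derivative_def has_derivative_within_alt
  proof (intro conjI allI impI)
    show "bounded_linear (\<lambda>h. h *\<^sub>R f t)" by (rule bounded_linear_scaleR_left)
    fix e :: real assume "e > 0"
    then obtain n where n: "1 / real (Suc n) < e" using nat_approx_posE by blast
    have "t \<notin> E (1 / real (Suc n))" using t by (auto simp: N_def)
    then obtain d where d: "d > 0" "\<And>s. s \<in> {a..b} \<Longrightarrow> norm (s - t) < d \<Longrightarrow>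
      norm (integral {a..s} f - integral {a..t} f - (s - t) *\<^sub>R f t) \<le> 1 / real (Suc n) * norm (s - t)"
      using t unfolding E_def by blast
    have "1 / real (Suc n) * norm (s - t) \<le> e * norm (s - t)" for s
      using n by (intro mult_right_mono) auto
    with d show "\<exists>d>0. \<forall>s\<in>{a..b}. norm (s - t) < d \<longrightarrow>
      norm (integral {a..s} f - integral {a..t} f - (s - t) *\<^sub>R f t) \<le> e * norm (s - t)"
      by (meson order_trans)
  qed
qed

section \<open>The control space\<close>

lemma L2_controls_square_integrable:
  assumes "u \<in> L2_controls"
  shows "(\<lambda>s. (norm (u s))\<^sup>2) absolutely_integrable_on {0..1}"
  using assms by (simp add: L2_controls_def absolutely_integrable_on_iff_nonneg integrable_on_lebesgue_on)

lemma L2_controls_square_integrable_on: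
  assumes "u \<in> L2_controls" "0 \<le> a" "b \<le> 1"
  shows "(\<lambda>s. (norm (u s))\<^sup>2) integrable_on {a..b}"
proof (rule integrable_on_subinterval)
  show "(\<lambda>s. (norm (u s))\<^sup>2) integrable_on {0..1}"
    using L2_controls_square_integrable[OF assms(1)] set_lebesgue_integral_eq_integral(1) by blast
qed (use assms in auto)

lemma L2_controls_measurable: "u \<in> L2_controls \<Longrightarrow> u \<in> borel_measurable (lebesgue_on {0..1})"
  by (simp add: L2_controls_def)

lemma L2_norm_square:
  assumes "u \<in> L2_controls"
  shows "(L2_norm u)\<^sup>2 = integral {0..1} (\<lambda>s. (norm (u s))\<^sup>2)"
proof -
  have "(LINT s|lebesgue_on {0..1}. (norm (u s))\<^sup>2) = integral {0..1} (\<lambda>s. (norm (u s))\<^sup>2)"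
    using assms by (intro lebesgue_integral_eq_integral) (auto simp: L2_controls_def)
  moreover have "0 \<le> (LINT s|lebesgue_on {0..1}. (norm (u s))\<^sup>2)"
    by (intro integral_nonneg_AE) simp
  ultimately show ?thesis unfolding L2_norm_def by simp
qed

lemma L2_norm_nonneg: "0 \<le> L2_norm u"
  unfolding L2_norm_def by (intro real_sqrt_ge_zero integral_nonneg_AE) simp

lemma L2_ball_subinterval_bound:
  assumes "u \<in> L2_ball B" "S \<subseteq> {0..1}" "(\<lambda>s. (norm (u s))\<^sup>2) integrable_on S"
  shows "integral S (\<lambda>s. (norm (u s))\<^sup>2) \<le> B\<^sup>2"
proof -
  have u: "u \<in> L2_controls" "L2_norm u \<le> B" using assms by (auto simp: L2_ball_def)
  have "integral S (\<lambda>s. (norm (u s))\<^sup>2) \<le> integral {0..1} (\<lambda>s. (norm (u s))\<^sup>2)"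
    using assms L2_controls_square_integrable_on[OF u(1)] by (intro integral_subset_le) auto
  also have "\<dots> = (L2_norm u)\<^sup>2" using L2_norm_square[OF u(1)] by simp
  also have "\<dots> \<le> B\<^sup>2" by (intro power_mono u(2) L2_norm_nonneg)
  finally show ?thesis .
qed

lemma L2_controls_inner_integrable:
  fixes u w :: "real \<Rightarrow> real ^ 'l"
  assumes "u \<in> L2_controls" "w \<in> L2_controls"
  shows "(\<lambda>s. u s \<bullet> w s) absolutely_integrable_on {0..1}"
proof (rule measurable_bounded_by_integrable_imp_absolutely_integrable)
  show "(\<lambda>s. u s \<bullet> w s) \<in> borel_measurable (lebesgue_on {0..1})"
    using assms[THEN L2_controls_measurable] by measurable
  show "(\<lambda>s. (norm (u s))\<^sup>2 + (norm (w s))\<^sup>2) integrable_on {0..1}"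
    using assms by (intro integrable_add L2_controls_square_integrable_on) auto
  show "norm (u s \<bullet> w s) \<le> (norm (u s))\<^sup>2 + (norm (w s))\<^sup>2" for s
  proof -
    have "norm (u s \<bullet> w s) \<le> norm (u s) * norm (w s)" by (simp add: Cauchy_Schwarz_ineq2)
    also have "\<dots> \<le> (norm (u s))\<^sup>2 + (norm (w s))\<^sup>2"
      using sum_squares_bound[of "norm (u s)" "norm (w s)"]
        mult_nonneg_nonneg[OF norm_ge_zero norm_ge_zero, of "u s" "w s"] by linarith
    finally show ?thesis .
  qed
qed simp

text \<open>
  The discriminant argument, applied to the nonnegative integral of \<open>|u - c w|\<^sup>2\<close> as a function of \<open>c\<close>.
\<close>

lemma L2_Cauchy_Schwarz:
  fixes u w :: "real \<Rightarrow> real ^ 'l"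
  assumes u: "u \<in> L2_controls" and w: "w \<in> L2_controls"
  shows "\<bar>integral {0..1} (\<lambda>s. w s \<bullet> u s)\<bar> \<le> L2_norm w * L2_norm u"
proof -
  let ?I = "integral {0..1} (\<lambda>s. w s \<bullet> u s)"
  let ?U = "(L2_norm u)\<^sup>2" and ?W = "(L2_norm w)\<^sup>2"
  have q: "0 \<le> ?U - 2 * c * ?I + c\<^sup>2 * ?W" for c
  proof -
    have "((\<lambda>s. (norm (u s))\<^sup>2 - (2 * c) * (w s \<bullet> u s) + c\<^sup>2 * (norm (w s))\<^sup>2) has_integral
        ?U - 2 * c * ?I + c\<^sup>2 * ?W) {0..1}"
      unfolding L2_norm_square[OF u] L2_norm_square[OF w]
      using L2_controls_square_integrable_on[OF u] L2_controls_square_integrable_on[OF w]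
        set_lebesgue_integral_eq_integral(1)[OF L2_controls_inner_integrable[OF w u]]
      by (intro has_integral_add has_integral_diff has_integral_mult_right integrable_integral) auto
    moreover have "0 \<le> (norm (u s))\<^sup>2 - (2 * c) * (w s \<bullet> u s) + c\<^sup>2 * (norm (w s))\<^sup>2" for s
    proof -
      have "(norm (u s - c *\<^sub>R w s))\<^sup>2 = (norm (u s))\<^sup>2 - (2 * c) * (w s \<bullet> u s) + c\<^sup>2 * (norm (w s))\<^sup>2"
        unfolding power2_norm_eq_inner
        by (simp add: inner_diff_left inner_diff_right inner_commute power2_eq_square)
      then show ?thesis by (metis zero_le_power2)
    qed
    ultimately show ?thesis by (rule has_integral_nonneg)
  qed
  have "?I\<^sup>2 \<le> ?W * ?U"
  proof (cases "?W = 0")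
    case True
    have "?I = 0"
    proof (rule ccontr)
      assume "?I \<noteq> 0"
      \<comment> \<open>For \<open>?W = 0\<close> the expression is affine in \<open>c\<close>; this \<open>c\<close> makes it equal to \<open>-1\<close>.\<close>
      then show False using q[of "(?U + 1) / (2 * ?I)"] True by (simp add: field_simps)
    qed
    then show ?thesis using True by simp
  next
    case False
    then have "?W > 0" by simp
    have "0 \<le> ?U - 2 * (?I / ?W) * ?I + (?I / ?W)\<^sup>2 * ?W" by (rule q)
    also have "\<dots> = ?U - ?I\<^sup>2 / ?W"
      using \<open>?W > 0\<close> by (simp add: power2_eq_square field_simps)
    finally show ?thesis using \<open>?W > 0\<close> by (simp add: field_simps)
  qed
  then have "?I\<^sup>2 \<le> (L2_norm w * L2_norm u)\<^sup>2" by (simp add: power_mult_distrib)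
  then show ?thesis
    using abs_le_square_iff[of ?I "L2_norm w * L2_norm u"] by (simp add: L2_norm_nonneg)
qed

text \<open>
  The functionals against which weak convergence is tested in the sequel.
\<close>

lemma inner_in_L2_dual:
  fixes w :: "real \<Rightarrow> real ^ 'l"
  assumes w: "w \<in> L2_controls"
  shows "(\<lambda>v. integral {0..1} (\<lambda>s. w s \<bullet> v s)) \<in> L2_dual"
  unfolding L2_dual_def
proof (intro CollectI conjI ballI allI)
  note int = set_lebesgue_integral_eq_integral(1)[OF L2_controls_inner_integrable[OF w]]
  fix u v :: "real \<Rightarrow> real ^ 'l" assume "u \<in> L2_controls" "v \<in> L2_controls"
  then show "integral {0..1} (\<lambda>s. w s \<bullet> (u s + v s))
      = integral {0..1} (\<lambda>s. w s \<bullet> u s) + integral {0..1} (\<lambda>s. w s \<bullet> v s)"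
    unfolding inner_add_right by (intro Henstock_Kurzweil_Integration.integral_add int)
next
  fix c and u :: "real \<Rightarrow> real ^ 'l"
  show "integral {0..1} (\<lambda>s. w s \<bullet> (c *\<^sub>R u s)) = c * integral {0..1} (\<lambda>s. w s \<bullet> u s)"
    by simp
next
  show "\<exists>C. \<forall>u\<in>L2_controls. \<bar>integral {0..1} (\<lambda>s. w s \<bullet> u s)\<bar> \<le> C * L2_norm u"
    using L2_Cauchy_Schwarz[OF _ w] by blast
qed

lemma L2_controls_continuous_mult_integrable:
  assumes u: "u \<in> L2_controls" and g: "continuous_on {0..1} g"
  shows "(\<lambda>s. g s * norm (u s)) absolutely_integrable_on {0..1::real}"
proof (rule absolutely_integrable_bounded_measurable_product_real)
  show "g \<in> borel_measurable (lebesgue_on {0..1})"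
    by (rule continuous_imp_measurable_on_sets_lebesgue[OF g]) simp
  show "bounded (g ` {0..1})"
    using g by (intro compact_imp_bounded compact_continuous_image) auto
  show "(\<lambda>s. norm (u s)) absolutely_integrable_on {0..1}"
  proof (rule measurable_bounded_by_integrable_imp_absolutely_integrable)
    show "(\<lambda>s. norm (u s)) \<in> borel_measurable (lebesgue_on {0..1})"
      using L2_controls_measurable[OF u] by measurable
    show "(\<lambda>s. 1 + (norm (u s))\<^sup>2) integrable_on {0..1}"
      using u by (intro integrable_add L2_controls_square_integrable_on) auto
    show "norm (norm (u s)) \<le> 1 + (norm (u s))\<^sup>2" for s
      using sum_squares_bound[of "norm (u s)" 1] norm_ge_zero[of "u s"]
      unfolding real_norm_def abs_norm_cancel power_one mult_1_right by linarith
  qed simp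
qed simp

lemma L2_controls_continuous_mult_integrable_on:
  assumes "u \<in> L2_controls" "continuous_on {0..1} g" "0 \<le> a" "b \<le> 1"
  shows "(\<lambda>s. g s * norm (u s)) integrable_on {a..b}"
  by (rule integrable_on_subinterval[OF set_lebesgue_integral_eq_integral(1)
        [OF L2_controls_continuous_mult_integrable[OF assms(1,2)]]]) (use assms in auto)

lemma L2_controls_norm_integrable_on:
  assumes "u \<in> L2_controls" "0 \<le> a" "b \<le> 1"
  shows "(\<lambda>s. norm (u s)) integrable_on {a..b}"
  using L2_controls_continuous_mult_integrable_on[OF assms(1) continuous_on_const[of _ 1] assms(2,3)]
  by simp

text \<open>
  Uniform integrability of a bounded set in \<open>L\<^sup>2\<close>: from \<open>x \<le> c + x\<^sup>2 / c\<close>, the integral of the norm over a set of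
  length at most \<open>\<delta>\<close> is at most \<open>c \<delta> + B\<^sup>2 / c\<close>. The bound is stated for divisions, the form that
  matches absolute continuity.
\<close>

lemma L2_ball_uniform_abs_continuity:
  assumes "\<epsilon> > 0" "B > 0"
  obtains \<delta> where "\<delta> > 0"
    "\<And>(u :: real \<Rightarrow> real ^ 'l) d. \<lbrakk>u \<in> L2_ball B; d division_of \<Union>d; \<Union>d \<subseteq> {0..1};
       (\<Sum>k\<in>d. Sup k - Inf k) < \<delta>\<rbrakk> \<Longrightarrow> (\<Sum>k\<in>d. integral k (\<lambda>s. norm (u s))) < \<epsilon>"
proof
  \<comment> \<open>Makes \<open>B\<^sup>2 / c\<close> equal to \<open>\<epsilon> / 2\<close>.\<close>
  define c where "c = 2 * B\<^sup>2 / \<epsilon>"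
  have "c > 0" using assms by (simp add: c_def)
  then show "\<epsilon> / (2 * c) > 0" using assms by simp
  fix u :: "real \<Rightarrow> real ^ 'l" and d
  assume u: "u \<in> L2_ball B" and d: "d division_of \<Union>d" "\<Union>d \<subseteq> {0..1}"
    "(\<Sum>k\<in>d. Sup k - Inf k) < \<epsilon> / (2 * c)"
  then have u': "u \<in> L2_controls" by (simp add: L2_ball_def)
  have k: "\<exists>a b. k = {a..b} \<and> a \<le> b \<and> 0 \<le> a \<and> b \<le> 1" if kd: "k \<in> d" for k
  proof -
    obtain a b where ab: "k = {a..b}"
      using division_ofD(4)[OF d(1) kd] by auto
    moreover have "k \<noteq> {}" "k \<subseteq> {0..1}"
      using division_ofD(3)[OF d(1) kd] d(2) kd by auto
    ultimately show ?thesis unfolding ab by (intro exI[of _ a] exI[of _ b]) simp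
  qed
  have int: "(\<lambda>s. (norm (u s))\<^sup>2) integrable_on k" if "k \<in> d" for k
    using k[OF that] L2_controls_square_integrable_on[OF u'] by auto
  have "integral k (\<lambda>s. norm (u s)) \<le> c * (Sup k - Inf k) + integral k (\<lambda>s. (norm (u s))\<^sup>2) / c"
    if kd: "k \<in> d" for k
  proof -
    obtain a b where ab: "k = {a..b}" "a \<le> b" "0 \<le> a" "b \<le> 1" using k[OF kd] by blast
    have R: "((\<lambda>s. c + (norm (u s))\<^sup>2 / c) has_integral ((b - a) *\<^sub>R c + integral k (\<lambda>s. (norm (u s))\<^sup>2) / c)) k"
      using int[OF kd] has_integral_const_real[of c a b] ab
      by (intro has_integral_add has_integral_divide integrable_integral) auto
    have N: "((\<lambda>s. norm (u s)) has_integral integral k (\<lambda>s. norm (u s))) k"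
      using ab L2_controls_norm_integrable_on[OF u'] by (simp add: integrable_integral)
    have le: "x \<le> c + x\<^sup>2 / c" for x
    proof (cases "x \<le> c")
      case False
      then have "x * c \<le> x\<^sup>2" using \<open>c > 0\<close> by (simp add: power2_eq_square)
      then have "x \<le> x\<^sup>2 / c" using \<open>c > 0\<close> by (simp add: field_simps)
      then show ?thesis using \<open>c > 0\<close> by simp
    qed (use \<open>c > 0\<close> in \<open>simp add: add_increasing2\<close>)
    have "integral k (\<lambda>s. norm (u s)) \<le> (b - a) *\<^sub>R c + integral k (\<lambda>s. (norm (u s))\<^sup>2) / c"
      by (rule has_integral_le[OF N R le])
    then show ?thesis using ab by (simp add: mult.commute)
  qed
  then have "(\<Sum>k\<in>d. integral k (\<lambda>s. norm (u s)))
      \<le> (\<Sum>k\<in>d. c * (Sup k - Inf k) + integral k (\<lambda>s. (norm (u s))\<^sup>2) / c)"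
    by (rule sum_mono)
  also have "\<dots> = c * (\<Sum>k\<in>d. Sup k - Inf k) + (\<Sum>k\<in>d. integral k (\<lambda>s. (norm (u s))\<^sup>2)) / c"
    by (simp add: sum.distrib sum_distrib_left sum_divide_distrib)
  also have "(\<Sum>k\<in>d. integral k (\<lambda>s. (norm (u s))\<^sup>2)) = integral (\<Union>d) (\<lambda>s. (norm (u s))\<^sup>2)"
    by (rule integral_combine_division_bottomup[OF d(1) int, symmetric])
  also have "c * (\<Sum>k\<in>d. Sup k - Inf k) + integral (\<Union>d) (\<lambda>s. (norm (u s))\<^sup>2) / c < c * (\<epsilon> / (2 * c)) + B\<^sup>2 / c"
  proof (rule add_less_le_mono)
    show "c * (\<Sum>k\<in>d. Sup k - Inf k) < c * (\<epsilon> / (2 * c))"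
      using d(3) \<open>c > 0\<close> by (intro mult_strict_left_mono)
    have "integral (\<Union>d) (\<lambda>s. (norm (u s))\<^sup>2) \<le> B\<^sup>2"
      by (intro L2_ball_subinterval_bound[OF u d(2)] integrable_combine_division[OF d(1)] int)
    then show "integral (\<Union>d) (\<lambda>s. (norm (u s))\<^sup>2) / c \<le> B\<^sup>2 / c"
      using \<open>c > 0\<close> by (simp add: divide_right_mono)
  qed
  also have "\<dots> = \<epsilon>" using assms by (simp add: c_def power2_eq_square)
  finally show "(\<Sum>k\<in>d. integral k (\<lambda>s. norm (u s))) < \<epsilon>" .
qed

lemma L2_ball_uniform_abs_continuity_Icc:
  assumes "\<epsilon> > 0" "B > 0"
  obtains \<delta> where "\<delta> > 0"
    "\<And>(u :: real \<Rightarrow> real ^ 'l) s t. \<lbrakk>u \<in> L2_ball B; 0 \<le> s; s \<le> t; t \<le> 1; t - s < \<delta>\<rbrakk>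
       \<Longrightarrow> integral {s..t} (\<lambda>s. norm (u s)) < \<epsilon>"
proof -
  obtain \<delta> where \<delta>: "\<delta> > 0"
    "\<And>(u :: real \<Rightarrow> real ^ 'l) d. \<lbrakk>u \<in> L2_ball B; d division_of \<Union>d; \<Union>d \<subseteq> {0..1};
       (\<Sum>k\<in>d. Sup k - Inf k) < \<delta>\<rbrakk> \<Longrightarrow> (\<Sum>k\<in>d. integral k (\<lambda>s. norm (u s))) < \<epsilon>"
    using L2_ball_uniform_abs_continuity[OF assms] by blast
  show thesis
  proof (rule that[OF \<delta>(1)])
    fix u :: "real \<Rightarrow> real ^ 'l" and s t :: real
    assume "u \<in> L2_ball B" "0 \<le> s" "s \<le> t" "t \<le> 1" "t - s < \<delta>"
    then show "integral {s..t} (\<lambda>s. norm (u s)) < \<epsilon>"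
      using \<delta>(2)[of u "{{s..t}}"] division_of_self[of s t] by simp
  qed
qed

text \<open>
  The estimate behind both uniqueness and existence: with respect to the weight \<open>exp (c s)\<close>, integration
  against \<open>L |u|\<close> has norm at most one half. The rate \<open>c\<close> is chosen so that the inequality
  \<open>2 p q \<le> p\<^sup>2 + q\<^sup>2\<close>, with \<open>p = |u| / (2 B)\<close> and \<open>q = L B exp (c (s - t))\<close>, gives two terms
  whose integrals are each at most one quarter.
\<close>

lemma L2_ball_exponential_weight:
  fixes u :: "real \<Rightarrow> real ^ 'l"
  assumes u: "u \<in> L2_ball B" and "B > 0" and c: "c = 2 * (L * B)\<^sup>2" and t: "0 \<le> t" "t \<le> 1"
  shows "integral {0..t} (\<lambda>s. L * norm (u s) * exp (c * s)) \<le> exp (c * t) / 2"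
proof -
  have u': "u \<in> L2_controls" using u by (simp add: L2_ball_def)
  let ?R = "\<lambda>s. exp (c * t) * ((norm (u s))\<^sup>2 / (4 * B\<^sup>2) + c / 2 * exp (2 * c * (s - t)))"
  let ?J = "integral {0..t} (\<lambda>s. (norm (u s))\<^sup>2)"
  have "((\<lambda>s. c / 2 * exp (2 * c * (s - t))) has_integral
      (exp (2 * c * (t - t)) / 4 - exp (2 * c * (0 - t)) / 4)) {0..t}"
    using t by (intro fundamental_theorem_of_calculus)
      (auto intro!: derivative_eq_intros simp flip: has_real_derivative_iff_has_vector_derivative)
  then have R: "(?R has_integral exp (c * t) * (?J / (4 * B\<^sup>2) + (exp (2 * c * (t - t)) / 4 - exp (2 * c * (0 - t)) / 4))) {0..t}"
    using t L2_controls_square_integrable_on[OF u']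
    by (intro has_integral_mult_right has_integral_add has_integral_divide integrable_integral) auto
  have "(\<lambda>s. (L * exp (c * s)) * norm (u s)) integrable_on {0..t}"
    using t by (intro L2_controls_continuous_mult_integrable_on u' continuous_intros) auto
  then have "(\<lambda>s. L * norm (u s) * exp (c * s)) integrable_on {0..t}"
    by (simp add: mult.assoc mult.commute[of "norm _"])
  then have "integral {0..t} (\<lambda>s. L * norm (u s) * exp (c * s)) \<le>
      exp (c * t) * (?J / (4 * B\<^sup>2) + (exp (2 * c * (t - t)) / 4 - exp (2 * c * (0 - t)) / 4))"
  proof (intro has_integral_le[OF integrable_integral R])
    fix s
    define p where "p = norm (u s) / (2 * B)"
    define q where "q = L * B * exp (c * (s - t))"
    have "L * norm (u s) * exp (c * s) = exp (c * t) * (2 * p * q)"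
      using \<open>B > 0\<close> by (simp add: p_def q_def exp_diff right_diff_distrib field_simps)
    also have "\<dots> \<le> exp (c * t) * (p\<^sup>2 + q\<^sup>2)"
      using sum_squares_bound[of p q] by simp
    also have "q\<^sup>2 = c / 2 * exp (2 * c * (s - t))"
      by (simp add: q_def c power_mult_distrib exp_double[symmetric] mult.assoc)
    also have "p\<^sup>2 = (norm (u s))\<^sup>2 / (4 * B\<^sup>2)" by (simp add: p_def power_divide power_mult_distrib)
    finally show "L * norm (u s) * exp (c * s) \<le> ?R s" .
  qed
  also have "\<dots> \<le> exp (c * t) * (1 / 4 + 1 / 4)"
  proof (intro mult_left_mono add_mono)
    have "?J \<le> B\<^sup>2"
      using t by (intro L2_ball_subinterval_bound[OF u] L2_controls_square_integrable_on u') auto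
    then show "?J / (4 * B\<^sup>2) \<le> 1 / 4" using \<open>B > 0\<close> by (simp add: field_simps)
  qed simp_all
  finally show ?thesis by simp
qed

text \<open>
  At the maximum point of \<open>exp (- c t) w t\<close>, the weighted estimate absorbs half of the left-hand side into the
  integral term. In this form a kernel that is merely square integrable needs no differentiation.
\<close>

lemma L2_Gronwall:
  fixes u :: "real \<Rightarrow> real ^ 'l"
  assumes u: "u \<in> L2_ball B" and "B > 0" "L \<ge> 0"
    and w: "continuous_on {0..1} w" "\<And>t. t \<in> {0..1} \<Longrightarrow> 0 \<le> w t"
    and le: "\<And>t. t \<in> {0..1} \<Longrightarrow> w t \<le> A + integral {0..t} (\<lambda>s. L * norm (u s) * w s)"
    and t: "t \<in> {0..1}"
  shows "w t \<le> 2 * A * exp (2 * (L * B)\<^sup>2)"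
proof -
  define c where "c = 2 * (L * B)\<^sup>2"
  have u': "u \<in> L2_controls" using u by (simp add: L2_ball_def)
  have "continuous_on {0..1} (\<lambda>t. exp (- c * t) * w t)"
    by (intro continuous_intros w)
  from continuous_attains_sup[OF compact_Icc _ this]
  obtain t0 where t0: "t0 \<in> {0..1}"
    and sup: "\<And>s. s \<in> {0..1} \<Longrightarrow> exp (- c * s) * w s \<le> exp (- c * t0) * w t0"
    by auto
  define m where "m = exp (- c * t0) * w t0"
  have wle: "w s \<le> m * exp (c * s)" if "s \<in> {0..1}" for s
    using sup[OF that] by (simp add: m_def exp_minus field_simps)
  have m0: "0 \<le> m" using w(2)[OF t0] by (simp add: m_def)
  have wm: "w t0 = m * exp (c * t0)" by (simp add: m_def exp_minus)
  have int: "(\<lambda>s. L * norm (u s) * g s) integrable_on {0..t0}" if "continuous_on {0..1} g" for g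
  proof -
    have "(\<lambda>s. (L * g s) * norm (u s)) integrable_on {0..t0}"
      using t0 that by (intro L2_controls_continuous_mult_integrable_on u' continuous_intros) auto
    then show ?thesis by (simp add: mult.assoc mult.commute[of "norm _"])
  qed
  have "w t0 \<le> A + integral {0..t0} (\<lambda>s. L * norm (u s) * w s)" by (rule le[OF t0])
  also have "integral {0..t0} (\<lambda>s. L * norm (u s) * w s) \<le> integral {0..t0} (\<lambda>s. L * norm (u s) * (m * exp (c * s)))"
    using t0 \<open>L \<ge> 0\<close> by (intro integral_le int w continuous_intros mult_left_mono wle) auto
  also have "\<dots> = m * integral {0..t0} (\<lambda>s. L * norm (u s) * exp (c * s))"
    by (simp add: mult.left_commute[of _ m] flip: integral_mult_right)
  also have "\<dots> \<le> m * (exp (c * t0) / 2)"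
    using t0 by (intro mult_left_mono m0 L2_ball_exponential_weight[OF u \<open>B > 0\<close> c_def]) auto
  finally have *: "m * exp (c * t0) \<le> 2 * A" using wm by simp
  have "c \<ge> 0" by (simp add: c_def)
  have "m * 1 \<le> m * exp (c * t0)" using t0 m0 \<open>c \<ge> 0\<close> by (intro mult_left_mono) auto
  then have "m \<le> 2 * A" using * by simp
  have "w t \<le> m * exp (c * t)" by (rule wle[OF t])
  also have "\<dots> \<le> m * exp c"
    using m0 t \<open>c \<ge> 0\<close> by (intro mult_left_mono) (auto simp: mult_left_le)
  also have "\<dots> \<le> 2 * A * exp c" using \<open>m \<le> 2 * A\<close> by simp
  finally show ?thesis by (simp add: c_def)
qed

section \<open>Trajectories and flows of bounded Lipschitz fields\<close>

lemma abs_continuous_on_Icc_subinterval: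
  assumes "abs_continuous_on_Icc a b f" "{c..d} \<subseteq> {a..b}"
  shows "abs_continuous_on_Icc c d f"
  unfolding abs_continuous_on_Icc_def
proof (intro allI impI)
  fix \<epsilon> :: real assume "\<epsilon> > 0"
  with assms(1) obtain \<delta> where "\<delta> > 0" "\<And>D. D division_of \<Union>D \<and> \<Union>D \<subseteq> {a..b} \<and> (\<Sum>k\<in>D. Sup k - Inf k) < \<delta> \<Longrightarrow>
        (\<Sum>k\<in>D. norm (f (Sup k) - f (Inf k))) < \<epsilon>"
    unfolding abs_continuous_on_Icc_def by blast
  then show "\<exists>\<delta>>0. \<forall>D. D division_of \<Union>D \<and> \<Union>D \<subseteq> {c..d} \<and> (\<Sum>k\<in>D. Sup k - Inf k) < \<delta> \<longrightarrow>
        (\<Sum>k\<in>D. norm (f (Sup k) - f (Inf k))) < \<epsilon>"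
    using assms(2) by (intro exI[of _ \<delta>] conjI allI impI) (blast intro: subset_trans)+
qed

lemma AE_lebesgue_on_iff_negligible:
  assumes "S \<in> sets lebesgue"
  shows "(AE x in lebesgue_on S. P x) \<longleftrightarrow> (\<exists>N. negligible N \<and> (\<forall>x\<in>S - N. P x))"
proof -
  have "(AE x in lebesgue_on S. P x) \<longleftrightarrow> (AE x in lebesgue. x \<in> S \<longrightarrow> P x)"
    using assms by (simp add: AE_restrict_space_iff)
  also have "\<dots> \<longleftrightarrow> (\<exists>N. negligible N \<and> {x. \<not> (x \<in> S \<longrightarrow> P x)} \<subseteq> N)"
    by (rule eventually_ae_filter_negligible)
  also have "\<dots> \<longleftrightarrow> (\<exists>N. negligible N \<and> (\<forall>x\<in>S - N. P x))" by blast
  finally show ?thesis .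
qed

text \<open>
  All estimates on trajectories use the fields only through a common bound and a common Lipschitz constant.
\<close>

locale bounded_Lipschitz_fields =
  fixes F :: "'l::finite \<Rightarrow> real ^ 'n \<Rightarrow> real ^ 'n" and C :: real
  assumes F_bound: "norm (F i y) \<le> C"
    and F_Lipschitz: "norm (F i y - F i z) \<le> C * norm (y - z)"
begin

definition velocity :: "(real \<Rightarrow> real ^ 'l) \<Rightarrow> real \<Rightarrow> real ^ 'n \<Rightarrow> real ^ 'n" where
  "velocity u s y = (\<Sum>i\<in>UNIV. (u s $ i) *\<^sub>R F i y)"

text \<open>
  A control of size \<open>|u|\<close> gives a velocity of size at most \<open>L |u|\<close> and Lipschitz constant at most \<open>L |u|\<close>.
\<close>

definition L :: real where "L = real CARD('l) * C"

lemma C_nonneg: "0 \<le> C"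
  using F_bound norm_ge_zero order_trans by blast

lemma L_nonneg: "0 \<le> L"
  by (simp add: L_def C_nonneg)

lemma norm_velocity_le: "norm (velocity u s y) \<le> L * norm (u s)"
proof -
  have "norm (velocity u s y) \<le> (\<Sum>i\<in>(UNIV::'l set). norm (u s) * C)"
    unfolding velocity_def
  proof (rule sum_norm_le)
    fix i
    show "norm ((u s $ i) *\<^sub>R F i y) \<le> norm (u s) * C"
      using mult_mono[OF component_le_norm_cart[of "u s" i] F_bound[of i y]] by simp
  qed
  then show ?thesis by (simp add: L_def mult_ac)
qed

lemma norm_velocity_diff_le: "norm (velocity u s y - velocity u s z) \<le> L * norm (u s) * norm (y - z)"
proof -
  have "velocity u s y - velocity u s z = (\<Sum>i\<in>UNIV. (u s $ i) *\<^sub>R (F i y - F i z))"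
    by (simp add: velocity_def sum_subtractf algebra_simps)
  also have "norm \<dots> \<le> (\<Sum>i\<in>(UNIV::'l set). norm (u s) * (C * norm (y - z)))"
  proof (rule sum_norm_le)
    fix i
    show "norm ((u s $ i) *\<^sub>R (F i y - F i z)) \<le> norm (u s) * (C * norm (y - z))"
      using mult_mono[OF component_le_norm_cart[of "u s" i] F_Lipschitz[of i y z]] by simp
  qed
  finally show ?thesis by (simp add: L_def mult_ac)
qed

lemma F_continuous: "continuous_on S (F i)"
  by (rule continuous_on_subset[OF _ subset_UNIV], rule lipschitz_on_continuous_on[of C])
     (auto simp: lipschitz_on_def dist_norm C_nonneg F_Lipschitz)

lemma velocity_integrable:
  assumes u: "u \<in> L2_controls" and y: "continuous_on {0..1} y"
  shows "(\<lambda>s. velocity u s (y s)) absolutely_integrable_on {0..1}"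
proof (rule measurable_bounded_by_integrable_imp_absolutely_integrable)
  have "(\<lambda>s. u s \<bullet> axis i 1) \<in> borel_measurable (lebesgue_on {0..1})" for i
    using L2_controls_measurable[OF u] by measurable
  then have m1: "(\<lambda>s. u s $ i) \<in> borel_measurable (lebesgue_on {0..1})" for i
    by (simp add: inner_axis)
  have m2: "(\<lambda>s. F i (y s)) \<in> borel_measurable (lebesgue_on {0..1})" for i
    by (intro continuous_imp_measurable_on_sets_lebesgue continuous_on_compose2[OF F_continuous y]) auto
  show "(\<lambda>s. velocity u s (y s)) \<in> borel_measurable (lebesgue_on {0..1})"
    unfolding velocity_def by (intro borel_measurable_sum borel_measurable_scaleR m1 m2)
  show "(\<lambda>s. L * norm (u s)) integrable_on {0..1}"
    using L2_controls_continuous_mult_integrable_on[OF u continuous_on_const] by simp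
qed (simp_all add: norm_velocity_le)

lemma velocity_integrable_on:
  assumes "u \<in> L2_controls" "continuous_on {0..1} y" "0 \<le> a" "b \<le> 1"
  shows "(\<lambda>s. velocity u s (y s)) integrable_on {a..b}"
  by (rule integrable_on_subinterval[OF set_lebesgue_integral_eq_integral(1)
        [OF velocity_integrable[OF assms(1,2)]]]) (use assms in auto)

lemma norm_integral_velocity_le:
  assumes "u \<in> L2_controls" "continuous_on {0..1} y" "0 \<le> a" "b \<le> 1"
  shows "norm (integral {a..b} (\<lambda>s. velocity u s (y s))) \<le> L * integral {a..b} (\<lambda>s. norm (u s))"
proof -
  have "norm (integral {a..b} (\<lambda>s. velocity u s (y s))) \<le> integral {a..b} (\<lambda>s. L * norm (u s))"
    using L2_controls_continuous_mult_integrable_on[OF assms(1) continuous_on_const assms(3,4)]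
    by (intro integral_norm_bound_integral velocity_integrable_on assms norm_velocity_le) simp
  then show ?thesis by simp
qed

text \<open>
  The integral form of the differential equation, equivalent to \<open>caratheodory_solution\<close> for square integrable
  controls.
\<close>

definition trajectory :: "(real \<Rightarrow> real ^ 'l) \<Rightarrow> real ^ 'n \<Rightarrow> (real \<Rightarrow> real ^ 'n) \<Rightarrow> bool" where
  "trajectory u x0 y \<longleftrightarrow> continuous_on {0..1} y \<and>
     (\<forall>t\<in>{0..1}. y t = x0 + integral {0..t} (\<lambda>s. velocity u s (y s)))"

lemma trajectory_increment:
  assumes u: "u \<in> L2_controls" and y: "trajectory u x0 y" and ab: "0 \<le> a" "a \<le> b" "b \<le> 1"
  shows "y b - y a = integral {a..b} (\<lambda>s. velocity u s (y s))"
proof -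
  have "integral {0..a} (\<lambda>s. velocity u s (y s)) + integral {a..b} (\<lambda>s. velocity u s (y s))
      = integral {0..b} (\<lambda>s. velocity u s (y s))"
    using y ab by (intro Henstock_Kurzweil_Integration.integral_combine velocity_integrable_on u)
      (auto simp: trajectory_def)
  moreover have "y a = x0 + integral {0..a} (\<lambda>s. velocity u s (y s))"
    "y b = x0 + integral {0..b} (\<lambda>s. velocity u s (y s))"
    using y ab by (auto simp: trajectory_def)
  ultimately show ?thesis by (simp add: algebra_simps)
qed

text \<open>
  The velocity is dominated by \<open>L |u|\<close>, so absolute continuity is the uniform integrability of \<open>u\<close>; the
  derivative exists almost everywhere by Lebesgue differentiation.
\<close>

lemma trajectory_imp_caratheodory_solution:
  assumes u: "u \<in> L2_controls" and y: "trajectory u x0 y"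
  shows "caratheodory_solution F u x0 y"
  unfolding caratheodory_solution_def
proof (intro conjI)
  have cont: "continuous_on {0..1} y" and eq: "\<And>t. t \<in> {0..1} \<Longrightarrow> y t = x0 + integral {0..t} (\<lambda>s. velocity u s (y s))"
    using y by (auto simp: trajectory_def)
  define B where "B = L2_norm u + 1"
  have "B > 0" "u \<in> L2_ball B" using u L2_norm_nonneg[of u] by (auto simp: B_def L2_ball_def)
  show "y 0 = x0" using eq[of 0] by simp
  show "abs_continuous_on_Icc 0 1 y"
    unfolding abs_continuous_on_Icc_def
  proof (intro allI impI)
    fix \<epsilon> :: real assume "\<epsilon> > 0"
    then have "\<epsilon> / (L + 1) > 0" using L_nonneg by simp
    then obtain \<delta> where "\<delta> > 0" and \<delta>: "\<And>(v :: real \<Rightarrow> real ^ 'l) d. \<lbrakk>v \<in> L2_ball B; d division_of \<Union>d; \<Union>d \<subseteq> {0..1};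
       (\<Sum>k\<in>d. Sup k - Inf k) < \<delta>\<rbrakk> \<Longrightarrow> (\<Sum>k\<in>d. integral k (\<lambda>s. norm (v s))) < \<epsilon> / (L + 1)"
      using L2_ball_uniform_abs_continuity[OF _ \<open>B > 0\<close>] by blast
    have "(\<Sum>k\<in>d. norm (y (Sup k) - y (Inf k))) < \<epsilon>"
      if d: "d division_of \<Union>d" "\<Union>d \<subseteq> {0..1}" "(\<Sum>k\<in>d. Sup k - Inf k) < \<delta>" for d
    proof -
      have "norm (y (Sup k) - y (Inf k)) \<le> L * integral k (\<lambda>s. norm (u s))
          \<and> 0 \<le> integral k (\<lambda>s. norm (u s))" if kd: "k \<in> d" for k
      proof -
        obtain a b where ab: "k = {a..b}"
          using division_ofD(4)[OF d(1) kd] by auto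
        have "k \<noteq> {}" "k \<subseteq> {0..1}"
          using division_ofD(3)[OF d(1) kd] d(2) kd by auto
        then have ab': "0 \<le> a" "a \<le> b" "b \<le> 1" unfolding ab by auto
        then show ?thesis
          unfolding ab using trajectory_increment[OF u y ab'] norm_integral_velocity_le[OF u cont, of a b]
          by (auto intro!: Henstock_Kurzweil_Integration.integral_nonneg L2_controls_norm_integrable_on u)
      qed
      then have "(\<Sum>k\<in>d. norm (y (Sup k) - y (Inf k))) \<le> (\<Sum>k\<in>d. (L + 1) * integral k (\<lambda>s. norm (u s)))"
        by (intro sum_mono) (simp add: distrib_right add_increasing2)
      also have "\<dots> = (L + 1) * (\<Sum>k\<in>d. integral k (\<lambda>s. norm (u s)))" by (simp add: sum_distrib_left)
      also have "\<dots> < (L + 1) * (\<epsilon> / (L + 1))"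
        using \<delta>[OF \<open>u \<in> L2_ball B\<close> d] L_nonneg by (intro mult_strict_left_mono) auto
      finally show ?thesis using L_nonneg by simp
    qed
    then show "\<exists>\<delta>>0. \<forall>d. d division_of \<Union>d \<and> \<Union>d \<subseteq> {0..1} \<and> (\<Sum>k\<in>d. Sup k - Inf k) < \<delta> \<longrightarrow>
        (\<Sum>k\<in>d. norm (y (Sup k) - y (Inf k))) < \<epsilon>"
      using \<open>\<delta> > 0\<close> by blast
  qed
  obtain N where N: "negligible N" "\<And>t. t \<in> {0..1} - N \<Longrightarrow>
      ((\<lambda>t. integral {0..t} (\<lambda>s. velocity u s (y s))) has_vector_derivative velocity u t (y t)) (at t within {0..1})"
    using indefinite_integral_has_vector_derivative_AE[OF velocity_integrable_on[OF u cont order.refl order.refl]]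
    by blast
  have "(y has_vector_derivative velocity u t (y t)) (at t within {0..1})" if t: "t \<in> {0..1} - N" for t
  proof -
    have "((\<lambda>t. x0 + integral {0..t} (\<lambda>s. velocity u s (y s))) has_vector_derivative 0 + velocity u t (y t))
        (at t within {0..1})"
      by (intro has_vector_derivative_add has_vector_derivative_const N(2) t)
    then show ?thesis
      using t eq by (auto intro: has_vector_derivative_transform)
  qed
  then show "AE s in lebesgue_on {0..1}. (y has_vector_derivative (\<Sum>i\<in>UNIV. (u s $ i) *\<^sub>R F i (y s))) (at s within {0..1})"
    using N(1) by (subst AE_lebesgue_on_iff_negligible) (auto simp: velocity_def)
qed

lemma caratheodory_solution_imp_trajectory:
  assumes u: "u \<in> L2_controls" and y: "caratheodory_solution F u x0 y"
  shows "trajectory u x0 y"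
proof -
  have ac: "abs_continuous_on_Icc 0 1 y" and y0: "y 0 = x0"
    using y by (auto simp: caratheodory_solution_def)
  obtain N where N: "negligible N"
    "\<And>t. t \<in> {0..1} - N \<Longrightarrow> (y has_vector_derivative velocity u t (y t)) (at t within {0..1})"
    using y unfolding caratheodory_solution_def velocity_def[symmetric]
    by (subst (asm) AE_lebesgue_on_iff_negligible) auto
  have I: "((\<lambda>s. velocity u s (y s)) has_integral (y t - y 0)) {0..t}" if t: "t \<in> {0..1}" for t
  proof (rule abs_continuous_FTC[OF _ _ N(1)])
    show "abs_continuous_on_Icc 0 t y"
      using t by (intro abs_continuous_on_Icc_subinterval[OF ac]) auto
    show "(y has_vector_derivative velocity u s (y s)) (at s within {0..t})" if "s \<in> {0..t} - N" for s
      using t that by (intro has_vector_derivative_within_subset[OF N(2)]) auto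
  qed (use t in auto)
  have eq: "y t = x0 + integral {0..t} (\<lambda>s. velocity u s (y s))" if "t \<in> {0..1}" for t
    using integral_unique[OF I[OF that]] y0 by simp
  have "(\<lambda>s. velocity u s (y s)) integrable_on {0..1}"
    using I[of 1] by auto
  then have "continuous_on {0..1} (\<lambda>t. x0 + integral {0..t} (\<lambda>s. velocity u s (y s)))"
    by (intro continuous_intros indefinite_integral_continuous_1)
  then have "continuous_on {0..1} y"
    by (rule continuous_on_eq) (simp only: eq)
  with eq show ?thesis by (simp add: trajectory_def)
qed

text \<open>
  An approximate solution of the integral equation stays close to the exact one. With \<open>z\<close> an exact trajectory
  from another initial point this is Lipschitz dependence on the initial point; with \<open>z\<close> a trajectory of another control it
  gives weak continuity.
\<close>

lemma trajectory_stability: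
  assumes u: "u \<in> L2_ball B" and "B > 0" and y: "trajectory u x0 y"
    and z: "continuous_on {0..1} z"
    and err: "\<And>t. t \<in> {0..1} \<Longrightarrow> norm (z t - (x0 + integral {0..t} (\<lambda>s. velocity u s (z s)))) \<le> A"
    and t: "t \<in> {0..1}"
  shows "norm (y t - z t) \<le> 2 * A * exp (2 * (L * B)\<^sup>2)"
proof (rule L2_Gronwall[OF u \<open>B > 0\<close> L_nonneg _ _ _ t])
  have u': "u \<in> L2_controls" using u by (simp add: L2_ball_def)
  have cont: "continuous_on {0..1} y" using y by (simp add: trajectory_def)
  show "continuous_on {0..1} (\<lambda>t. norm (y t - z t))"
    by (intro continuous_intros cont z)
  fix t :: real assume t: "t \<in> {0..1}"
  show "0 \<le> norm (y t - z t)" by simp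
  have "(\<lambda>s. (L * norm (y s - z s)) * norm (u s)) integrable_on {0..t}"
    using t by (intro L2_controls_continuous_mult_integrable_on u' continuous_intros cont z) auto
  then have int: "(\<lambda>s. L * norm (u s) * norm (y s - z s)) integrable_on {0..t}"
    by (simp add: mult.assoc mult.commute[of "norm (u _)"])
  let ?V = "\<lambda>w. integral {0..t} (\<lambda>s. velocity u s (w s))"
  have "y t - z t = (?V y - ?V z) - (z t - (x0 + ?V z))"
    using y t by (simp add: trajectory_def)
  also have "norm \<dots> \<le> norm (?V y - ?V z) + norm (z t - (x0 + ?V z))"
    by (rule norm_triangle_ineq4)
  also have "?V y - ?V z = integral {0..t} (\<lambda>s. velocity u s (y s) - velocity u s (z s))"
    using t by (intro Henstock_Kurzweil_Integration.integral_diff[symmetric] velocity_integrable_on u' cont z) auto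
  also have "norm \<dots> \<le> integral {0..t} (\<lambda>s. L * norm (u s) * norm (y s - z s))"
    using t by (intro integral_norm_bound_integral int norm_velocity_diff_le
        integrable_diff velocity_integrable_on u' cont z) auto
  finally show "norm (y t - z t) \<le> A + integral {0..t} (\<lambda>s. L * norm (u s) * norm (y s - z s))"
    using err[OF t] by simp
qed

text \<open>
  In the unknown \<open>z t = exp (- c t) y t\<close> the integral operator is a contraction with factor one half for the plain
  sup norm, by the weighted estimate. Extending the functions constantly beyond \<open>[0,1]\<close> places them in
  the complete space of bounded continuous functions on the line.
\<close>

lemma trajectory_exists:
  assumes u: "u \<in> L2_controls"
  obtains y where "trajectory u x0 y"
proof -
  define B where "B = L2_norm u + 1"
  have "B > 0" and uB: "u \<in> L2_ball B" using u L2_norm_nonneg[of u] by (auto simp: B_def L2_ball_def)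
  define c where "c = 2 * (L * B)\<^sup>2"
  define h where "h z t = exp (- c * t) *\<^sub>R (x0 + integral {0..t} (\<lambda>s. velocity u s (exp (c * s) *\<^sub>R z s)))"
    for z :: "real \<Rightarrow> real ^ 'n" and t
  have cz: "continuous_on S (\<lambda>s. exp (c * s) *\<^sub>R apply_bcontfun z s)" for z :: "real \<Rightarrow>\<^sub>C (real ^ 'n)" and S
    by (intro continuous_intros continuous_on_apply_bcontfun)
  have "\<exists>g :: real \<Rightarrow>\<^sub>C (real ^ 'n). \<forall>x. g x = h z (clamp 0 1 x)" for z :: "real \<Rightarrow>\<^sub>C (real ^ 'n)"
  proof -
    have "continuous_on (cbox 0 1) (h z)"
      unfolding h_def box_real
      by (intro continuous_intros indefinite_integral_continuous_1 velocity_integrable_on u cz) auto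
    from continuous_on_cbox_bcontfunE[OF this] show ?thesis by blast
  qed
  then obtain T :: "(real \<Rightarrow>\<^sub>C (real ^ 'n)) \<Rightarrow> (real \<Rightarrow>\<^sub>C (real ^ 'n))"
    where T: "\<And>z x. T z x = h z (clamp 0 1 x)" by metis
  have contr: "norm (h z1 t - h z2 t) \<le> 1 / 2 * dist z1 z2" if t: "t \<in> {0..1}"
    for z1 z2 :: "real \<Rightarrow>\<^sub>C (real ^ 'n)" and t
  proof -
    let ?v = "\<lambda>z s. velocity u s (exp (c * s) *\<^sub>R apply_bcontfun z s)"
    have t': "0 \<le> t" "t \<le> 1" using t by auto
    have "(\<lambda>s. (dist z1 z2 * L * exp (c * s)) * norm (u s)) integrable_on {0..t}"
      using t' by (intro L2_controls_continuous_mult_integrable_on u continuous_intros) auto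
    then have int: "(\<lambda>s. dist z1 z2 * (L * norm (u s) * exp (c * s))) integrable_on {0..t}"
      by (simp add: mult.assoc mult.commute[of "norm (u _)"])
    have "h z1 t - h z2 t = exp (- c * t) *\<^sub>R (integral {0..t} (?v z1) - integral {0..t} (?v z2))"
      by (simp add: h_def algebra_simps)
    moreover have "integral {0..t} (?v z1) - integral {0..t} (?v z2) = integral {0..t} (\<lambda>s. ?v z1 s - ?v z2 s)"
      using t' by (intro Henstock_Kurzweil_Integration.integral_diff[symmetric] velocity_integrable_on u cz) auto
    ultimately have "norm (h z1 t - h z2 t) = exp (- c * t) * norm (integral {0..t} (\<lambda>s. ?v z1 s - ?v z2 s))"
      by (simp only: norm_scaleR abs_exp_cancel)
    also have "\<dots> \<le> exp (- c * t) * (dist z1 z2 * (exp (c * t) / 2))"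
    proof (rule mult_left_mono)
      have "norm (integral {0..t} (\<lambda>s. ?v z1 s - ?v z2 s))
          \<le> integral {0..t} (\<lambda>s. dist z1 z2 * (L * norm (u s) * exp (c * s)))"
      proof (rule integral_norm_bound_integral[OF _ int])
        show "(\<lambda>s. ?v z1 s - ?v z2 s) integrable_on {0..t}"
          using t' by (intro integrable_diff velocity_integrable_on u cz) auto
        fix s
        have "norm (?v z1 s - ?v z2 s) \<le> L * norm (u s) * norm (exp (c * s) *\<^sub>R z1 s - exp (c * s) *\<^sub>R z2 s)"
          by (rule norm_velocity_diff_le)
        also have "exp (c * s) *\<^sub>R z1 s - exp (c * s) *\<^sub>R z2 s = exp (c * s) *\<^sub>R (z1 s - z2 s)"
          by (simp add: algebra_simps)
        also have "norm \<dots> = exp (c * s) * dist (z1 s) (z2 s)" by (simp add: dist_norm)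
        also have "L * norm (u s) * \<dots> \<le> L * norm (u s) * (exp (c * s) * dist z1 z2)"
          using L_nonneg by (intro mult_left_mono dist_bounded) auto
        finally show "norm (?v z1 s - ?v z2 s) \<le> dist z1 z2 * (L * norm (u s) * exp (c * s))"
          by (simp add: mult_ac)
      qed
      also have "\<dots> = dist z1 z2 * integral {0..t} (\<lambda>s. L * norm (u s) * exp (c * s))" by simp
      also have "\<dots> \<le> dist z1 z2 * (exp (c * t) / 2)"
        by (intro mult_left_mono L2_ball_exponential_weight[OF uB \<open>B > 0\<close> c_def t']) auto
      finally show "norm (integral {0..t} (\<lambda>s. ?v z1 s - ?v z2 s)) \<le> dist z1 z2 * (exp (c * t) / 2)" .
    qed simp
    also have "\<dots> = 1 / 2 * dist z1 z2" by (simp add: exp_minus)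
    finally show ?thesis .
  qed
  have cl: "clamp 0 1 x \<in> {0..1}" for x :: real
    using clamp_in_interval[of 0 1 x] by simp
  have "dist (T z1) (T z2) \<le> 1 / 2 * dist z1 z2" for z1 z2
    by (rule dist_bound) (simp only: T dist_norm[of "h _ _"] contr[OF cl])
  then obtain z where z: "T z = z"
    using banach_fix_type[of "1/2" T] by auto
  define y where "y t = exp (c * t) *\<^sub>R z t" for t
  have "y t = x0 + integral {0..t} (\<lambda>s. velocity u s (y s))" if "t \<in> {0..1}" for t
  proof -
    have "z t = h z t" using T[of z t] that by (simp add: z)
    then have "y t = (exp (c * t) * exp (- c * t)) *\<^sub>R (x0 + integral {0..t} (\<lambda>s. velocity u s (y s)))"
      by (simp add: y_def h_def)
    then show ?thesis by (simp add: exp_minus)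
  qed
  moreover have "continuous_on {0..1} y" unfolding y_def by (rule cz)
  ultimately show thesis by (intro that[of y]) (simp add: trajectory_def)
qed

lemma trajectories_Lipschitz:
  assumes u: "u \<in> L2_ball B" and "B > 0" and y: "trajectory u x0 y" and z: "trajectory u z0 z" and t: "t \<in> {0..1}"
  shows "norm (y t - z t) \<le> 2 * norm (x0 - z0) * exp (2 * (L * B)\<^sup>2)"
  using z by (intro trajectory_stability[OF u \<open>B > 0\<close> y _ _ t]) (auto simp: trajectory_def norm_minus_commute)

text \<open>
  Two trajectories from the same point agree by the Lipschitz estimate, so the definite description in \<open>flow\<close> has
  exactly one candidate.
\<close>

lemma flow_eq_trajectory:
  assumes u: "u \<in> L2_controls" and y: "trajectory u x0 y"
  shows "flow F u x0 = y 1"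
  unfolding flow_def
proof (rule the_equality)
  show "\<exists>x. caratheodory_solution F u x0 x \<and> x 1 = y 1"
    using trajectory_imp_caratheodory_solution[OF u y] by blast
  fix w assume "\<exists>x. caratheodory_solution F u x0 x \<and> x 1 = w"
  then obtain x where "caratheodory_solution F u x0 x" and w: "x 1 = w" by blast
  then have x: "trajectory u x0 x" by (intro caratheodory_solution_imp_trajectory[OF u])
  have B: "u \<in> L2_ball (L2_norm u + 1)" "0 < L2_norm u + 1"
    using u L2_norm_nonneg[of u] by (auto simp: L2_ball_def)
  from trajectories_Lipschitz[OF B x y, of 1] w show "w = y 1" by simp
qed

lemma flow_Lipschitz:
  assumes u: "u \<in> L2_ball B" and "B > 0"
  shows "dist (flow F u x) (flow F u z) \<le> 2 * exp (2 * (L * B)\<^sup>2) * dist x z"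
proof -
  have u': "u \<in> L2_controls" using u by (simp add: L2_ball_def)
  obtain y where y: "trajectory u x y" by (rule trajectory_exists[OF u'])
  obtain y' where y': "trajectory u z y'" by (rule trajectory_exists[OF u'])
  show ?thesis
    using trajectories_Lipschitz[OF assms y y', of 1]
    unfolding flow_eq_trajectory[OF u' y] flow_eq_trajectory[OF u' y'] by (simp add: dist_norm mult_ac)
qed

text \<open>
  Keeps all endpoints that start in a compact set within one ball, uniformly over a ball of controls.
\<close>

lemma flow_displacement_le:
  assumes u: "u \<in> L2_ball B"
  shows "norm (flow F u x - x) \<le> L * (1 + B\<^sup>2)"
proof -
  have u': "u \<in> L2_controls" using u by (simp add: L2_ball_def)
  obtain y where y: "trajectory u x y" by (rule trajectory_exists[OF u'])
  have "flow F u x - x = integral {0..1} (\<lambda>s. velocity u s (y s))"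
    using y by (simp add: flow_eq_trajectory[OF u' y] trajectory_def)
  also have "norm \<dots> \<le> L * integral {0..1} (\<lambda>s. norm (u s))"
    using y by (intro norm_integral_velocity_le u') (auto simp: trajectory_def)
  also have "\<dots> \<le> L * integral {0..1} (\<lambda>s. 1 + (norm (u s))\<^sup>2)"
  proof (intro mult_left_mono L_nonneg integral_le L2_controls_norm_integrable_on
      integrable_add integrable_const_ivl L2_controls_square_integrable_on u')
    show "norm (u s) \<le> 1 + (norm (u s))\<^sup>2" for s
      using sum_squares_bound[of "norm (u s)" 1] norm_ge_zero[of "u s"]
      unfolding power_one mult_1_right by linarith
  qed auto
  also have "integral {0..1} (\<lambda>s. 1 + (norm (u s))\<^sup>2) = 1 + integral {0..1} (\<lambda>s. (norm (u s))\<^sup>2)"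
    using L2_controls_square_integrable_on[OF u']
    by (subst Henstock_Kurzweil_Integration.integral_add) (auto intro: integrable_const_ivl)
  also have "L * \<dots> \<le> L * (1 + B\<^sup>2)"
    by (intro mult_left_mono add_left_mono L_nonneg L2_ball_subinterval_bound[OF u]
        L2_controls_square_integrable_on u') auto
  finally show ?thesis .
qed

end

section \<open>Weak continuity of the flow in the control\<close>

text \<open>
  Convergence on a finite net is uniform there, and equicontinuity carries it to the points in between.
  The lemma is applied to integrals as functions of time and to flows as functions of the initial point.
\<close>

lemma equicontinuous_pointwise_imp_uniform_limit:
  fixes f :: "nat \<Rightarrow> 'a::metric_space \<Rightarrow> 'b::metric_space"
  assumes "compact K"
    and equi: "\<And>\<epsilon>. \<epsilon> > 0 \<Longrightarrow> \<exists>\<delta>>0. \<forall>M. \<forall>x\<in>K. \<forall>y\<in>K. dist x y < \<delta> \<longrightarrow> dist (f M x) (f M y) < \<epsilon>"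
    and lim: "\<And>x. x \<in> K \<Longrightarrow> (\<lambda>M. f M x) \<longlonglongrightarrow> g x"
  shows "uniform_limit K f g sequentially"
proof (rule uniform_limitI)
  fix \<epsilon> :: real assume "\<epsilon> > 0"
  then have e4: "\<epsilon> / 4 > 0" by simp
  obtain \<delta> where "\<delta> > 0" and \<delta>: "\<And>M x y. \<lbrakk>x \<in> K; y \<in> K; dist x y < \<delta>\<rbrakk> \<Longrightarrow> dist (f M x) (f M y) < \<epsilon> / 4"
    using equi[OF e4] by blast
  have cov: "K \<subseteq> (\<Union>p\<in>K. ball p \<delta>)" using \<open>\<delta> > 0\<close> by auto
  obtain P where P: "P \<subseteq> K" "finite P" "K \<subseteq> (\<Union>p\<in>P. ball p \<delta>)"
    by (rule compactE_image[OF \<open>compact K\<close> open_ball cov])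
  have "\<forall>\<^sub>F M in sequentially. \<forall>p\<in>P. dist (f M p) (g p) < \<epsilon> / 4"
    using P(1) by (intro eventually_ball_finite P(2) ballI tendstoD[OF lim e4]) auto
  then show "\<forall>\<^sub>F M in sequentially. \<forall>x\<in>K. dist (f M x) (g x) < \<epsilon>"
  proof eventually_elim
    case (elim M)
    show ?case
    proof
      fix x assume x: "x \<in> K"
      then obtain p where p: "p \<in> P" "dist p x < \<delta>" using P(3) by auto
      then have "p \<in> K" using P(1) by auto
      have 1: "dist (f M p) (f M x) < \<epsilon> / 4" for M
        by (rule \<delta>[OF \<open>p \<in> K\<close> x p(2)])
      have "dist (g p) (g x) \<le> \<epsilon> / 4"
        by (rule LIMSEQ_le_const2[OF tendsto_dist[OF lim[OF \<open>p \<in> K\<close>] lim[OF x]]])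
          (use 1 in \<open>auto intro: less_imp_le\<close>)
      moreover have "dist (f M x) (g x) \<le> dist (f M p) (f M x) + dist (f M p) (g p) + dist (g p) (g x)"
        using dist_triangle[of "f M x" "g x" "f M p"] dist_triangle[of "f M p" "g x" "g p"]
        by (simp add: dist_commute)
      ultimately show "dist (f M x) (g x) < \<epsilon>"
        using 1[of M] elim p(1) \<open>\<epsilon> > 0\<close> by force
    qed
  qed
qed

context bounded_Lipschitz_fields
begin

text \<open>
  Each coordinate of the integral is the pairing of the control with the fixed square integrable function
  \<open>w\<close> whose components are the corresponding coordinates of \<open>F\<^sub>i(y)\<close>, cut off at time \<open>t\<close>.
\<close>

lemma integral_velocity_tendsto:
  assumes us: "\<And>M. us M \<in> L2_controls" and weak: "L2_weakly_converges us u"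
    and y: "continuous_on {0..1} y" and t: "t \<in> {0..1}"
  shows "(\<lambda>M. integral {0..t} (\<lambda>s. velocity (us M) s (y s))) \<longlonglongrightarrow> integral {0..t} (\<lambda>s. velocity u s (y s))"
proof (rule vec_tendstoI)
  fix j
  have u: "u \<in> L2_controls" using weak by (simp add: L2_weakly_converges_def)
  define w :: "real \<Rightarrow> real ^ 'l" where "w s = (\<chi> i. if s \<in> {0..t} then F i (y s) $ j else 0)" for s
  have "w \<in> L2_controls"
  proof -
    have "(\<lambda>s. F i (y s) $ j) \<in> borel_measurable (lebesgue_on {0..1})" for i
      by (intro continuous_imp_measurable_on_sets_lebesgue continuous_intros
          continuous_on_compose2[OF F_continuous y]) auto
    then have wi: "(\<lambda>s. if s \<in> {0..t} then F i (y s) $ j else 0) \<in> borel_measurable (lebesgue_on {0..1})" for i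
      by (intro measurable_If_set) (auto simp: sets_restrict_space_iff)
    have weq: "w = (\<lambda>s. \<Sum>i\<in>UNIV. (if s \<in> {0..t} then F i (y s) $ j else 0) *\<^sub>R axis i 1)"
      by (auto simp: w_def fun_eq_iff vec_eq_iff axis_def if_distrib cong: if_cong)
    have wm: "w \<in> borel_measurable (lebesgue_on {0..1})"
      unfolding weq by (intro borel_measurable_sum borel_measurable_scaleR wi borel_measurable_const)
    have "norm (w s) \<le> real CARD('l) * C" for s
    proof -
      have "norm (w s) \<le> (\<Sum>i\<in>UNIV. \<bar>w s $ i\<bar>)" by (rule norm_le_l1_cart)
      also have "\<dots> \<le> (\<Sum>i\<in>(UNIV::'l set). C)"
        using component_le_norm_cart[of "F _ (y s)" j] F_bound[of _ "y s"] C_nonneg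
        by (intro sum_mono) (auto simp: w_def intro: order_trans)
      finally show ?thesis by simp
    qed
    then have "(norm (w s))\<^sup>2 \<le> (real CARD('l) * C)\<^sup>2" for s
      by (intro power_mono) auto
    then have "(\<lambda>s. (norm (w s))\<^sup>2) absolutely_integrable_on {0..1}"
      using wm
      by (intro measurable_bounded_by_integrable_imp_absolutely_integrable[of _ _ "\<lambda>s. (real CARD('l) * C)\<^sup>2"]
          integrable_const_ivl) auto
    then have "integrable (lebesgue_on {0..1}) (\<lambda>s. (norm (w s))\<^sup>2)"
      by (rule absolutely_integrable_imp_integrable) simp
    with wm show ?thesis by (simp add: L2_controls_def)
  qed
  have eq: "integral {0..t} (\<lambda>s. velocity v s (y s)) $ j = integral {0..1} (\<lambda>s. w s \<bullet> v s)"
    if v: "v \<in> L2_controls" for v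
  proof -
    have "integral {0..t} (\<lambda>s. velocity v s (y s)) $ j = integral {0..t} (\<lambda>s. velocity v s (y s) $ j)"
      using integral_component_eq_cart[OF velocity_integrable_on[OF v y, of 0 t]] t by auto
    also have "\<dots> = integral {0..1} (\<lambda>s. if s \<in> {0..t} then velocity v s (y s) $ j else 0)"
      using t by (subst Henstock_Kurzweil_Integration.integral_restrict_Int) (simp add: Int_absorb1 min_def)
    also have "(\<lambda>s. if s \<in> {0..t} then velocity v s (y s) $ j else 0) = (\<lambda>s. w s \<bullet> v s)"
      by (auto simp: fun_eq_iff w_def velocity_def inner_vec_def mult.commute)
    finally show ?thesis .
  qed
  have "(\<lambda>M. integral {0..1} (\<lambda>s. w s \<bullet> us M s)) \<longlonglongrightarrow> integral {0..1} (\<lambda>s. w s \<bullet> u s)"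
    using weak inner_in_L2_dual[OF \<open>w \<in> L2_controls\<close>] by (auto simp: L2_weakly_converges_def)
  then show "(\<lambda>M. integral {0..t} (\<lambda>s. velocity (us M) s (y s)) $ j) \<longlonglongrightarrow>
      integral {0..t} (\<lambda>s. velocity u s (y s)) $ j"
    using eq us u by simp
qed

text \<open>
  The limit trajectory \<open>y\<close> solves the equation of \<open>us M\<close> up to the error \<open>\<integral>\<^sub>0\<^sup>t (velocity u - velocity (us M)) (y)\<close>,
  which tends to zero uniformly in \<open>t\<close>.
\<close>

lemma flow_tendsto_pointwise:
  assumes us: "\<And>M. us M \<in> L2_ball B" and "B > 0" and weak: "L2_weakly_converges us u"
  shows "(\<lambda>M. flow F (us M) x) \<longlonglongrightarrow> flow F u x"
proof -
  have us': "us M \<in> L2_controls" for M using us by (simp add: L2_ball_def)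
  have u: "u \<in> L2_controls" using weak by (simp add: L2_weakly_converges_def)
  obtain y where y: "trajectory u x y" by (rule trajectory_exists[OF u])
  then have cont: "continuous_on {0..1} y" by (simp add: trajectory_def)
  let ?V = "\<lambda>v t. integral {0..t} (\<lambda>s. velocity v s (y s))"
  have "uniform_limit {0..1} (\<lambda>M. ?V (us M)) (?V u) sequentially"
  proof (rule equicontinuous_pointwise_imp_uniform_limit)
    fix \<epsilon> :: real assume "\<epsilon> > 0"
    then have "\<epsilon> / (L + 1) > 0" using L_nonneg by simp
    then obtain \<delta> where "\<delta> > 0" and \<delta>: "\<And>(v :: real \<Rightarrow> real ^ 'l) s t. \<lbrakk>v \<in> L2_ball B; 0 \<le> s; s \<le> t; t \<le> 1; t - s < \<delta>\<rbrakk>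
       \<Longrightarrow> integral {s..t} (\<lambda>s. norm (v s)) < \<epsilon> / (L + 1)"
      using L2_ball_uniform_abs_continuity_Icc[OF _ \<open>B > 0\<close>] by blast
    have main: "dist (?V (us M) s) (?V (us M) t) < \<epsilon>"
      if st: "0 \<le> s" "s \<le> t" "t \<le> 1" "t - s < \<delta>" for M s t
    proof -
      have "?V (us M) s + integral {s..t} (\<lambda>r. velocity (us M) r (y r)) = ?V (us M) t"
        using st by (intro Henstock_Kurzweil_Integration.integral_combine velocity_integrable_on us' cont) auto
      then have "dist (?V (us M) s) (?V (us M) t) = norm (integral {s..t} (\<lambda>r. velocity (us M) r (y r)))"
        by (simp add: dist_norm norm_minus_commute algebra_simps flip: eq_diff_eq)
      also have "\<dots> \<le> L * integral {s..t} (\<lambda>r. norm (us M r))"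
        using st by (intro norm_integral_velocity_le us' cont)
      also have "\<dots> \<le> L * (\<epsilon> / (L + 1))"
        using \<delta>[OF us st, of M] L_nonneg by (intro mult_left_mono) auto
      also have "\<dots> < \<epsilon>" using \<open>\<epsilon> > 0\<close> L_nonneg by (simp add: field_simps)
      finally show ?thesis .
    qed
    have "dist (?V (us M) s) (?V (us M) t) < \<epsilon>"
      if "s \<in> {0..1}" "t \<in> {0..1}" "dist s t < \<delta>" for M s t
    proof (cases "s \<le> t")
      case True
      then show ?thesis using that by (intro main) (auto simp: dist_real_def)
    next
      case False
      then show ?thesis using that by (subst dist_commute, intro main) (auto simp: dist_real_def)
    qed
    then show "\<exists>\<delta>>0. \<forall>M. \<forall>s\<in>{0..1}. \<forall>t\<in>{0..1}. dist s t < \<delta> \<longrightarrow> dist (?V (us M) s) (?V (us M) t) < \<epsilon>"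
      using \<open>\<delta> > 0\<close> by blast
  qed (auto intro: integral_velocity_tendsto[OF us' weak cont])
  note unif = this
  define E where "E = 2 * exp (2 * (L * B)\<^sup>2)"
  have "E > 0" by (simp add: E_def)
  show ?thesis
  proof (rule tendstoI)
    fix \<epsilon> :: real assume "\<epsilon> > 0"
    then have e: "\<epsilon> / (2 * E) > 0" using \<open>E > 0\<close> by simp
    show "\<forall>\<^sub>F M in sequentially. dist (flow F (us M) x) (flow F u x) < \<epsilon>"
      using uniform_limitD[OF unif e]
    proof eventually_elim
      case (elim M)
      obtain z where z: "trajectory (us M) x z" by (rule trajectory_exists[OF us'])
      have "norm (z 1 - y 1) \<le> 2 * (\<epsilon> / (2 * E)) * exp (2 * (L * B)\<^sup>2)"
      proof (rule trajectory_stability[OF us \<open>B > 0\<close> z cont])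
        fix t :: real assume t: "t \<in> {0..1}"
        have "y t - (x + ?V (us M) t) = ?V u t - ?V (us M) t"
          using y t by (simp add: trajectory_def)
        moreover have "norm (?V u t - ?V (us M) t) \<le> \<epsilon> / (2 * E)"
          using bspec[OF elim t] unfolding dist_norm norm_minus_commute[of "?V (us M) t"] by (rule less_imp_le)
        ultimately show "norm (y t - (x + ?V (us M) t)) \<le> \<epsilon> / (2 * E)" by (simp only:)
      qed simp
      also have "\<dots> = E * (\<epsilon> / (2 * E))" by (simp add: E_def)
      also have "\<dots> < \<epsilon>" using \<open>E > 0\<close> \<open>\<epsilon> > 0\<close> by simp
      finally show ?case
        by (simp add: dist_norm flow_eq_trajectory[OF us' z] flow_eq_trajectory[OF u y])
    qed
  qed
qed

theorem flow_tendsto_uniformly_on_compact: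
  assumes us: "\<And>M. us M \<in> L2_ball B" and "B > 0" and weak: "L2_weakly_converges us u" and "compact K"
  shows "uniform_limit K (\<lambda>M. flow F (us M)) (flow F u) sequentially"
proof (rule equicontinuous_pointwise_imp_uniform_limit[OF \<open>compact K\<close>])
  fix \<epsilon> :: real assume "\<epsilon> > 0"
  define E where "E = 2 * exp (2 * (L * B)\<^sup>2)"
  have "E > 0" by (simp add: E_def)
  have "dist (flow F (us M) x) (flow F (us M) y) < \<epsilon>" if "dist x y < \<epsilon> / E" for M x y
  proof -
    have "dist (flow F (us M) x) (flow F (us M) y) \<le> E * dist x y"
      unfolding E_def by (rule flow_Lipschitz[OF us \<open>B > 0\<close>])
    also have "\<dots> < \<epsilon>" using that \<open>E > 0\<close> by (simp add: field_simps)
    finally show ?thesis .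
  qed
  then show "\<exists>\<delta>>0. \<forall>M. \<forall>x\<in>K. \<forall>y\<in>K. dist x y < \<delta> \<longrightarrow> dist (flow F (us M) x) (flow F (us M) y) < \<epsilon>"
    using \<open>\<epsilon> > 0\<close> \<open>E > 0\<close> by (intro exI[of _ "\<epsilon> / E"]) auto
qed (rule flow_tendsto_pointwise[OF us \<open>B > 0\<close> weak])

end

section \<open>Smooth fields\<close>

lemma smooth_imp_differentiable:
  assumes "smooth f"
  shows "f differentiable (at x)"
proof -
  obtain U g where "UNIV \<subseteq> U" "\<forall>x. g x = f x" "\<forall>vs. \<forall>x\<in>U. iter_dderiv vs g differentiable (at x)"
    using assms unfolding smooth_on_def by auto
  then have "g = f" "iter_dderiv [] g differentiable (at x)" by blast+
  then show ?thesis by simp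
qed

lemma smooth_imp_continuous: "smooth f \<Longrightarrow> continuous_on S f"
  by (meson continuous_at_imp_continuous_on differentiable_imp_continuous_within smooth_imp_differentiable)

text \<open>
  The derivative is controlled by its values on the finitely many basis vectors, which are bounded
  by the derivatives of order one; the mean value inequality then gives the Lipschitz constant.
\<close>

lemma smooth_bounded_with_derivs_Lipschitz:
  assumes "smooth f" "bounded_with_derivs f"
  obtains C where "\<And>y. norm (f y) \<le> C" "\<And>y z. norm (f y - f z) \<le> C * norm (y - z)"
proof -
  have bd: "\<exists>c. \<forall>x. norm (iter_dderiv vs f x) \<le> c" for vs
    using assms(2) unfolding bounded_with_derivs_def bounded_iff by (metis rangeI)
  obtain c0 where c0: "\<And>x. norm (f x) \<le> c0" using bd[of "[]"] by auto
  have "\<exists>c. \<forall>x. norm (frechet_derivative f (at x) b) \<le> c" for b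
    using bd[of "[b]"] by simp
  then obtain c where c: "\<And>x b. norm (frechet_derivative f (at x) b) \<le> c b" by metis
  define B where "B = (\<Sum>b\<in>Basis. c b)"
  have D: "(f has_derivative frechet_derivative f (at x)) (at x)" for x
    using smooth_imp_differentiable[OF assms(1)] by (simp flip: frechet_derivative_works)
  have bound: "norm (frechet_derivative f (at x) h) \<le> B * norm h" for x h
  proof -
    have lin: "linear (frechet_derivative f (at x))" using D has_derivative_linear by blast
    have "frechet_derivative f (at x) h = frechet_derivative f (at x) (\<Sum>b\<in>Basis. (h \<bullet> b) *\<^sub>R b)"
      by (simp add: euclidean_representation)
    also have "\<dots> = (\<Sum>b\<in>Basis. (h \<bullet> b) *\<^sub>R frechet_derivative f (at x) b)"
      by (simp add: linear_sum[OF lin] linear_scale[OF lin])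
    also have "norm \<dots> \<le> (\<Sum>b\<in>Basis. norm h * c b)"
      by (rule sum_norm_le) (auto intro!: mult_mono Basis_le_norm c)
    finally show ?thesis by (simp add: B_def sum_distrib_left mult.commute)
  qed
  have lip: "norm (f y - f z) \<le> B * norm (y - z)" for y z
    by (rule differentiable_bound[of UNIV f "\<lambda>x. frechet_derivative f (at x)"])
      (auto intro: D onorm_le bound)
  show thesis
  proof (rule that[of "max c0 B"])
    show "norm (f y) \<le> max c0 B" for y using c0[of y] by simp
    show "norm (f y - f z) \<le> max c0 B * norm (y - z)" for y z
      by (rule order_trans[OF lip]) (intro mult_right_mono, auto)
  qed
qed

lemma smooth_bounded_fields_Lipschitz:
  fixes F :: "'l::finite \<Rightarrow> real ^ 'n \<Rightarrow> real ^ 'n"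
  assumes "\<And>i. smooth (F i)" "\<And>i. bounded_with_derivs (F i)"
  obtains C where "bounded_Lipschitz_fields F C"
proof -
  have "\<exists>C. (\<forall>y. norm (F i y) \<le> C) \<and> (\<forall>y z. norm (F i y - F i z) \<le> C * norm (y - z))" for i
    using smooth_bounded_with_derivs_Lipschitz[OF assms] by metis
  then obtain C where C: "\<And>i y. norm (F i y) \<le> C i" "\<And>i y z. norm (F i y - F i z) \<le> C i * norm (y - z)"
    by metis
  have le: "C i \<le> Max (range C)" for i by simp
  have "bounded_Lipschitz_fields F (Max (range C))"
  proof
    show "norm (F i y) \<le> Max (range C)" for i y
      using C(1)[of i y] le[of i] by linarith
    show "norm (F i y - F i z) \<le> Max (range C) * norm (y - z)" for i y z
      by (rule order_trans[OF C(2)]) (intro mult_right_mono le norm_ge_zero)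
  qed
  then show thesis by (rule that)
qed

section \<open>Empirical measures\<close>

text \<open>
  As an image of a counting measure, the empirical measure turns integrals into finite averages.
\<close>

lemma empirical_measure_eq_distr:
  fixes x :: "nat \<Rightarrow> 'a::euclidean_space"
  assumes "M \<ge> 1"
  shows "empirical_measure M x = distr (uniform_count_measure {1..M}) borel x"
proof -
  let ?D = "distr (uniform_count_measure {1..M}) borel x"
  have "empirical_measure M x = measure_of UNIV (sets borel) (emeasure ?D)"
    unfolding empirical_measure_def
  proof (rule measure_of_eq)
    fix A :: "'a set" assume "A \<in> sigma_sets UNIV (sets borel)"
    then have A: "A \<in> sets borel" by (metis sets.sigma_sets_eq space_borel)
    let ?J = "{j\<in>{1..M}. x j \<in> A}"
    have "(\<Sum>j = 1..M. emeasure (return borel (x j)) A) = (\<Sum>j = 1..M. of_bool (x j \<in> A))"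
      using A by (intro sum.cong) (auto simp: indicator_def)
    also have "\<dots> = of_nat (card ?J)"
      by (simp add: Int_def flip: of_nat_sum)
    finally have "ennreal (1 / real M) * (\<Sum>j = 1..M. emeasure (return borel (x j)) A) = ennreal (card ?J / M)"
      using ennreal_mult''[of "real (card ?J)" "1 / real M"] by (simp add: ennreal_of_nat_eq_real_of_nat mult.commute)
    also have "\<dots> = emeasure (uniform_count_measure {1..M}) ?J"
      by (subst emeasure_uniform_count_measure) auto
    also have "\<dots> = emeasure ?D A"
      using A by (subst emeasure_distr)
        (auto simp: space_uniform_count_measure intro!: arg_cong[where f="emeasure _"])
    finally show "ennreal (1 / real M) * (\<Sum>j = 1..M. emeasure (return borel (x j)) A) = emeasure ?D A" .
  qed simp
  also have "\<dots> = ?D"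
    using measure_of_of_measure[of ?D] by simp
  finally show ?thesis .
qed

lemma integral_empirical_measure:
  fixes x :: "nat \<Rightarrow> 'a::euclidean_space" and f :: "'a \<Rightarrow> real"
  assumes "M \<ge> 1" and "continuous_on UNIV f"
  shows "(\<integral>y. f y \<partial>empirical_measure M x) = (\<Sum>j=1..M. f (x j)) / real M"
proof -
  have "f \<in> borel_measurable borel" using assms(2) by (rule borel_measurable_continuous_onI)
  then have "(\<integral>y. f y \<partial>empirical_measure M x) = (\<integral>j. f (x j) \<partial>uniform_count_measure {1..M})"
    unfolding empirical_measure_eq_distr[OF assms(1)] by (intro integral_distr) auto
  then show ?thesis by (simp add: integral_uniform_count_measure)
qed

lemma integral_empirical_measure_diff_le:
  fixes x :: "nat \<Rightarrow> 'a::euclidean_space" and f h :: "'a \<Rightarrow> real"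
  assumes "M \<ge> 1" and "continuous_on UNIV f" "continuous_on UNIV h"
    and le: "\<And>j. j \<in> {1..M} \<Longrightarrow> \<bar>f (x j) - h (x j)\<bar> \<le> e"
  shows "\<bar>(\<integral>y. f y \<partial>empirical_measure M x) - (\<integral>y. h y \<partial>empirical_measure M x)\<bar> \<le> e"
proof -
  have "(\<integral>y. f y \<partial>empirical_measure M x) - (\<integral>y. h y \<partial>empirical_measure M x)
      = (\<Sum>j=1..M. f (x j) - h (x j)) / real M"
    using assms by (simp add: integral_empirical_measure sum_subtractf diff_divide_distrib)
  also have "\<bar>\<dots>\<bar> \<le> (\<Sum>j=1..M. e) / real M"
    unfolding abs_divide by (simp only: abs_of_nat)
      (intro divide_right_mono order_trans[OF sum_abs] sum_mono le of_nat_0_le_iff)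
  also have "\<dots> = e" using assms(1) by simp
  finally show ?thesis .
qed

text \<open>
  All measures live on the compact set \<open>K\<close>, so a continuous integrand can be truncated at its bound on
  \<open>K\<close> without changing any of the integrals, and the truncated integrand is bounded.
\<close>

lemma integral_empirical_measure_tendsto:
  fixes \<mu> :: "'a::euclidean_space measure" and \<alpha> :: "nat \<Rightarrow> nat \<Rightarrow> 'a" and f :: "'a \<Rightarrow> real"
  assumes "compact K"
    and pts: "\<And>M j. M \<ge> 1 \<Longrightarrow> j \<in> {1..M} \<Longrightarrow> \<alpha> M j \<in> K"
    and sets: "sets \<mu> = sets borel" and supp: "emeasure \<mu> (- K) = 0"
    and conv: "\<And>f :: 'a \<Rightarrow> real. continuous_on UNIV f \<Longrightarrow> bounded (range f) \<Longrightarrow>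
         (\<lambda>M. \<integral>x. f x \<partial>empirical_measure M (\<alpha> M)) \<longlonglongrightarrow> (\<integral>x. f x \<partial>\<mu>)"
    and f: "continuous_on UNIV f"
  shows "(\<lambda>M. \<integral>x. f x \<partial>empirical_measure M (\<alpha> M)) \<longlonglongrightarrow> (\<integral>x. f x \<partial>\<mu>)"
proof -
  have "bounded (f ` K)"
    using assms(1) f by (intro compact_imp_bounded compact_continuous_image) (auto intro: continuous_on_subset)
  then obtain b where b: "\<And>x. x \<in> K \<Longrightarrow> \<bar>f x\<bar> \<le> b" by (auto simp: bounded_iff)
  \<comment> \<open>Using \<open>|b|\<close> keeps the truncation bounds ordered even when \<open>K\<close> is empty.\<close>
  define h where "h x = max (- \<bar>b\<bar>) (min (f x) \<bar>b\<bar>)" for x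
  have hf: "h x = f x" if "x \<in> K" for x using b[OF that] by (auto simp: h_def)
  have hc: "continuous_on UNIV h" unfolding h_def by (intro continuous_intros f)
  have "bounded (range h)" unfolding bounded_iff by (intro exI[of _ "\<bar>b\<bar>"]) (auto simp: h_def)
  from conv[OF hc this] have hlim: "(\<lambda>M. \<integral>x. h x \<partial>empirical_measure M (\<alpha> M)) \<longlonglongrightarrow> (\<integral>x. h x \<partial>\<mu>)" .
  have ev: "\<forall>\<^sub>F M in sequentially. (\<integral>x. h x \<partial>empirical_measure M (\<alpha> M)) = (\<integral>x. f x \<partial>empirical_measure M (\<alpha> M))"
    using eventually_ge_at_top[of 1]
  proof eventually_elim
    case (elim M)
    then show ?case
      unfolding integral_empirical_measure[OF elim hc] integral_empirical_measure[OF elim f]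
      using pts[OF elim] hf by (intro arg_cong[where f="\<lambda>s. s / _"] sum.cong) auto
  qed
  have "(\<integral>x. h x \<partial>\<mu>) = (\<integral>x. f x \<partial>\<mu>)"
  proof (rule integral_cong_AE)
    show "h \<in> borel_measurable \<mu>" "f \<in> borel_measurable \<mu>"
      using hc f sets by (auto simp: measurable_cong_sets[OF sets refl] intro: borel_measurable_continuous_onI)
    have "- K \<in> null_sets \<mu>"
      using supp sets \<open>compact K\<close> by (auto simp: null_sets_def intro!: borel_open dest: compact_imp_closed)
    then show "AE x in \<mu>. h x = f x"
      by (rule AE_I') (use hf in auto)
  qed
  with Lim_transform_eventually[OF hlim ev] show ?thesis by simp
qed

section \<open>Gamma-convergence\<close>

context bounded_Lipschitz_fields
begin

lemma flow_continuous:
  assumes "u \<in> L2_controls"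
  shows "continuous_on S (flow F u)"
proof (rule lipschitz_on_continuous_on, rule lipschitz_onI)
  have "u \<in> L2_ball (L2_norm u + 1)" "0 < L2_norm u + 1"
    using assms L2_norm_nonneg[of u] by (auto simp: L2_ball_def)
  then show "dist (flow F u x) (flow F u z) \<le> 2 * exp (2 * (L * (L2_norm u + 1))\<^sup>2) * dist x z" for x z
    by (rule flow_Lipschitz)
qed simp

text \<open>
  On \<open>K\<close> the integrands converge uniformly: the endpoints stay in a fixed ball, on which \<open>a\<close> is uniformly continuous.
  Replacing \<open>us M\<close> by \<open>u\<close> in the integrand therefore costs a vanishing amount, and the remaining integrand does not
  depend on \<open>M\<close>. The sequence is shifted by one since \<open>us 0\<close> is arbitrary.
\<close>

lemma endpoint_cost_tendsto:
  fixes a :: "real ^ 'n \<Rightarrow> real" and \<Psi> :: "real ^ 'n \<Rightarrow> real ^ 'n" and \<mu> :: "(real ^ 'n) measure"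
  assumes a: "continuous_on UNIV a" and \<Psi>: "continuous_on UNIV \<Psi>"
    and K: "compact K"
    and pts: "\<And>M j. M \<ge> 1 \<Longrightarrow> j \<in> {1..M} \<Longrightarrow> \<alpha> M j \<in> K"
    and sets: "sets \<mu> = sets borel" and supp: "emeasure \<mu> (- K) = 0"
    and conv: "\<And>f :: real ^ 'n \<Rightarrow> real. continuous_on UNIV f \<Longrightarrow> bounded (range f) \<Longrightarrow>
         (\<lambda>M. \<integral>x. f x \<partial>empirical_measure M (\<alpha> M)) \<longlonglongrightarrow> (\<integral>x. f x \<partial>\<mu>)"
    and us: "\<And>M. M \<ge> 1 \<Longrightarrow> us M \<in> L2_ball \<rho>" and "\<rho> > 0" and weak: "L2_weakly_converges us u"
  shows "(\<lambda>M. \<integral>x. a (flow F (us M) x - \<Psi> x) \<partial>empirical_measure M (\<alpha> M))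
      \<longlonglongrightarrow> (\<integral>x. a (flow F u x - \<Psi> x) \<partial>\<mu>)"
proof (rule LIMSEQ_imp_Suc)
  define g where "g v x = a (flow F v x - \<Psi> x)" for v x
  have u: "u \<in> L2_controls" using weak by (simp add: L2_weakly_converges_def)
  define vs where "vs M = us (Suc M)" for M
  have vs: "vs M \<in> L2_ball \<rho>" for M using us[of "Suc M"] by (simp add: vs_def)
  have vweak: "L2_weakly_converges vs u"
    using weak unfolding L2_weakly_converges_def vs_def by (auto intro: LIMSEQ_Suc)
  have gc: "continuous_on UNIV (g v)" if "v \<in> L2_controls" for v
    unfolding g_def
    by (intro continuous_on_compose2[OF a] continuous_intros flow_continuous that \<Psi>) auto
  have "bounded ((\<lambda>x. x - \<Psi> x) ` K)"
    by (intro compact_imp_bounded compact_continuous_image K continuous_intros continuous_on_subset[OF \<Psi>]) auto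
  then obtain b where b: "\<And>x. x \<in> K \<Longrightarrow> norm (x - \<Psi> x) \<le> b" by (auto simp: bounded_iff)
  \<comment> \<open>Covers the two control radii that occur, \<open>\<rho>\<close> for the sequence and the norm of \<open>u\<close> for the limit.\<close>
  define D where "D = L * (1 + \<rho>\<^sup>2) + L * (1 + (L2_norm u)\<^sup>2) + b"
  have near: "flow F v x - \<Psi> x \<in> cball 0 D" if "x \<in> K" "v \<in> L2_ball B" "B = \<rho> \<or> B = L2_norm u" for v x B
  proof -
    have "norm (flow F v x - \<Psi> x) \<le> norm (flow F v x - x) + norm (x - \<Psi> x)"
      using norm_triangle_ineq[of "flow F v x - x" "x - \<Psi> x"] by simp
    also have "\<dots> \<le> L * (1 + B\<^sup>2) + b"
      by (intro add_mono flow_displacement_le[OF that(2)] b that(1))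
    also have "\<dots> \<le> D"
    proof -
      have "0 \<le> L * (1 + \<rho>\<^sup>2)" "0 \<le> L * (1 + (L2_norm u)\<^sup>2)"
        using L_nonneg by simp_all
      then show ?thesis using that(3) unfolding D_def by (elim disjE; hypsubst; linarith)
    qed
    finally show ?thesis by simp
  qed
  have "u \<in> L2_ball (L2_norm u)" using u by (simp add: L2_ball_def)
  note unear = near[OF _ this]
  have "uniform_limit K (\<lambda>M x. flow F (vs M) x - \<Psi> x) (\<lambda>x. flow F u x - \<Psi> x) sequentially"
    by (intro uniform_limit_minus uniform_limit_const
        flow_tendsto_uniformly_on_compact[OF vs \<open>\<rho> > 0\<close> vweak K])
  moreover have "uniformly_continuous_on (cball 0 D) a"
    by (intro compact_uniformly_continuous continuous_on_subset[OF a]) auto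
  ultimately have unif: "uniform_limit K (\<lambda>M. g (vs M)) (a \<circ> (\<lambda>x. flow F u x - \<Psi> x)) sequentially"
    unfolding g_def using near[OF _ vs] unear by (intro uniform_limit_compose always_eventually) auto
  have "(\<lambda>M. (\<integral>x. g (vs M) x \<partial>empirical_measure (Suc M) (\<alpha> (Suc M)))
      - (\<integral>x. g u x \<partial>empirical_measure (Suc M) (\<alpha> (Suc M)))) \<longlonglongrightarrow> 0"
  proof (rule LIMSEQ_I)
    fix e :: real assume "e > 0"
    then have "e / 2 > 0" by simp
    from uniform_limitD[OF unif this]
    obtain M0 where M0: "\<And>M x. M \<ge> M0 \<Longrightarrow> x \<in> K \<Longrightarrow> \<bar>g (vs M) x - g u x\<bar> < e / 2"
      unfolding eventually_sequentially by (auto simp: dist_real_def g_def)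
    have "\<bar>(\<integral>x. g (vs M) x \<partial>empirical_measure (Suc M) (\<alpha> (Suc M)))
      - (\<integral>x. g u x \<partial>empirical_measure (Suc M) (\<alpha> (Suc M)))\<bar> \<le> e / 2" if "M \<ge> M0" for M
    proof (rule integral_empirical_measure_diff_le)
      show "continuous_on UNIV (g (vs M))" "continuous_on UNIV (g u)"
        using gc u vs by (auto simp: L2_ball_def)
      show "\<bar>g (vs M) (\<alpha> (Suc M) j) - g u (\<alpha> (Suc M) j)\<bar> \<le> e / 2" if "j \<in> {1..Suc M}" for j
        using M0[OF \<open>M \<ge> M0\<close> pts[OF _ that]] by simp
    qed simp
    then show "\<exists>M0. \<forall>M\<ge>M0. norm ((\<integral>x. g (vs M) x \<partial>empirical_measure (Suc M) (\<alpha> (Suc M)))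
      - (\<integral>x. g u x \<partial>empirical_measure (Suc M) (\<alpha> (Suc M))) - 0) < e"
      using \<open>e > 0\<close> by (intro exI[of _ M0]) fastforce
  qed
  moreover have "(\<lambda>M. \<integral>x. g u x \<partial>empirical_measure (Suc M) (\<alpha> (Suc M))) \<longlonglongrightarrow> (\<integral>x. g u x \<partial>\<mu>)"
  proof (rule LIMSEQ_Suc[where f="\<lambda>M. \<integral>x. g u x \<partial>empirical_measure M (\<alpha> M)"])
    show "(\<lambda>M. \<integral>x. g u x \<partial>empirical_measure M (\<alpha> M)) \<longlonglongrightarrow> (\<integral>x. g u x \<partial>\<mu>)"
      by (rule integral_empirical_measure_tendsto[OF K _ sets supp _ gc[OF u]]) (fact pts, fact conv)
  qed
  ultimately have "(\<lambda>M. \<integral>x. g (vs M) x \<partial>empirical_measure (Suc M) (\<alpha> (Suc M))) \<longlonglongrightarrow> (\<integral>x. g u x \<partial>\<mu>)"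
    by (rule Lim_transform[rotated])
  then show "(\<lambda>M. \<integral>x. a (flow F (us (Suc M)) x - \<Psi> x) \<partial>empirical_measure (Suc M) (\<alpha> (Suc M)))
      \<longlonglongrightarrow> (\<integral>x. a (flow F u x - \<Psi> x) \<partial>\<mu>)"
    by (simp add: g_def vs_def)
qed

end

text \<open>
  The tangent to the squared norm at \<open>u\<close>, a weakly continuous affine minorant that touches it at \<open>u\<close>.
\<close>

lemma L2_norm_square_minorant:
  fixes u v :: "real \<Rightarrow> real ^ 'l"
  assumes "u \<in> L2_controls" "v \<in> L2_controls"
  shows "2 * integral {0..1} (\<lambda>s. u s \<bullet> v s) - (L2_norm u)\<^sup>2 \<le> (L2_norm v)\<^sup>2"
  using L2_Cauchy_Schwarz[OF assms(2,1)] sum_squares_bound[of "L2_norm u" "L2_norm v"] by linarith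

theorem theorem5p1:
  fixes F :: "'l::finite \<Rightarrow> real ^ 'n \<Rightarrow> real ^ 'n"
    and \<Psi> :: "real ^ 'n \<Rightarrow> real ^ 'n"
    and a :: "real ^ 'n \<Rightarrow> real"
    and \<beta> \<rho> :: real
    and K :: "(real ^ 'n) set"
    and \<alpha> :: "nat \<Rightarrow> nat \<Rightarrow> real ^ 'n"
    and \<mu> :: "(real ^ 'n) measure"
  assumes F_smooth: "\<And>i. smooth (F i)"
    and F_bounded: "\<And>i. bounded_with_derivs (F i)"
    and \<Psi>_diffeo: "diffeomorphism \<Psi>"
    and \<Psi>_diffeotopic: "diffeotopic_to_id \<Psi>"
    and a_smooth: "smooth a"
    and a_nonneg: "\<And>x. a x \<ge> 0"
    and a_zero: "a 0 = 0"
    and \<beta>_pos: "\<beta> > 0"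
    and K_compact: "compact K"
    and points_distinct: "\<And>M. M \<ge> 1 \<Longrightarrow> inj_on (\<alpha> M) {1..M}"
    and points_in_K: "\<And>M j. M \<ge> 1 \<Longrightarrow> j \<in> {1..M} \<Longrightarrow> \<alpha> M j \<in> K"
    and \<mu>_prob: "prob_space \<mu>"
    and \<mu>_borel: "sets \<mu> = sets borel"
    and \<mu>_supported: "emeasure \<mu> (- K) = 0"
    and empirical_weak_conv:
      "\<And>f :: real ^ 'n \<Rightarrow> real. continuous_on UNIV f \<Longrightarrow> bounded (range f) \<Longrightarrow>
         (\<lambda>M. \<integral>x. f x \<partial>empirical_measure M (\<alpha> M)) \<longlonglongrightarrow> (\<integral>x. f x \<partial>\<mu>)"
    and \<rho>_pos: "\<rho> > 0"
  shows "Gamma_converges (L2_ball \<rho>)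
           (\<lambda>M u. ereal (control_cost F \<Psi> a \<beta> (empirical_measure M (\<alpha> M)) u))
           (\<lambda>u. ereal (control_cost F \<Psi> a \<beta> \<mu> u))"
proof -
  obtain C where "bounded_Lipschitz_fields F C"
    by (rule smooth_bounded_fields_Lipschitz[OF F_smooth F_bounded])
  then interpret bounded_Lipschitz_fields F C .
  have a_cont: "continuous_on UNIV a" by (rule smooth_imp_continuous[OF a_smooth])
  have \<Psi>_cont: "continuous_on UNIV \<Psi>"
    using \<Psi>_diffeo by (intro smooth_imp_continuous) (simp add: diffeomorphism_def)
  have endpoint: "(\<lambda>M. \<integral>x. a (flow F (us M) x - \<Psi> x) \<partial>empirical_measure M (\<alpha> M))
      \<longlonglongrightarrow> (\<integral>x. a (flow F u x - \<Psi> x) \<partial>\<mu>)"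
    if "\<And>M. M \<ge> 1 \<Longrightarrow> us M \<in> L2_ball \<rho>" "L2_weakly_converges us u" for us u
    by (rule endpoint_cost_tendsto[OF a_cont \<Psi>_cont K_compact _ \<mu>_borel \<mu>_supported _ _ \<rho>_pos that(2)])
      (fact points_in_K, fact empirical_weak_conv, fact that(1))
  let ?G = "\<lambda>M u. control_cost F \<Psi> a \<beta> (empirical_measure M (\<alpha> M)) u"
  let ?G_lim = "control_cost F \<Psi> a \<beta> \<mu>"
  show ?thesis
    unfolding Gamma_converges_def
  proof (intro conjI allI impI ballI)
    fix us and u :: "real \<Rightarrow> real ^ 'l"
    assume "(\<forall>M\<ge>1. us M \<in> L2_ball \<rho>) \<and> L2_weakly_converges us u"
    then have us: "\<And>M. M \<ge> 1 \<Longrightarrow> us M \<in> L2_ball \<rho>" and weak: "L2_weakly_converges us u" by auto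
    have u: "u \<in> L2_controls" using weak by (simp add: L2_weakly_converges_def)
    let ?\<phi> = "\<lambda>v. integral {0..1} (\<lambda>s. u s \<bullet> v s)"
    let ?J = "\<lambda>M. (\<integral>x. a (flow F (us M) x - \<Psi> x) \<partial>empirical_measure M (\<alpha> M))
        + \<beta> / 2 * (2 * ?\<phi> (us M) - (L2_norm u)\<^sup>2)"
    have "(\<lambda>M. ?\<phi> (us M)) \<longlonglongrightarrow> ?\<phi> u"
      using weak inner_in_L2_dual[OF u] by (auto simp: L2_weakly_converges_def)
    moreover have "?\<phi> u = (L2_norm u)\<^sup>2"
      by (simp add: L2_norm_square[OF u] power2_norm_eq_inner)
    ultimately have "?J \<longlonglongrightarrow> (\<integral>x. a (flow F u x - \<Psi> x) \<partial>\<mu>)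
        + \<beta> / 2 * (2 * (L2_norm u)\<^sup>2 - (L2_norm u)\<^sup>2)"
      by (intro tendsto_intros endpoint us weak) auto
    then have "(\<lambda>M. ereal (?J M)) \<longlonglongrightarrow> ereal (?G_lim u)"
      by (simp add: control_cost_def)
    then have "ereal (?G_lim u) = liminf (\<lambda>M. ereal (?J M))"
      by (intro lim_imp_Liminf[symmetric]) auto
    also have "\<dots> \<le> liminf (\<lambda>M. ereal (?G M (us M)))"
    proof (rule Liminf_mono)
      show "\<forall>\<^sub>F M in sequentially. ereal (?J M) \<le> ereal (?G M (us M))"
        using eventually_ge_at_top[of 1]
      proof eventually_elim
        case (elim M)
        then have "us M \<in> L2_controls" using us by (simp add: L2_ball_def)
        from L2_norm_square_minorant[OF u this] \<beta>_pos show ?case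
          unfolding control_cost_def ereal_less_eq by (intro add_left_mono mult_left_mono) auto
      qed
    qed
    finally show "ereal (?G_lim u) \<le> liminf (\<lambda>M. ereal (?G M (us M)))" .
  next
    fix u :: "real \<Rightarrow> real ^ 'l" assume u: "u \<in> L2_ball \<rho>"
    then have weak: "L2_weakly_converges (\<lambda>M. u) u"
      by (simp add: L2_weakly_converges_def L2_ball_def)
    have "(\<lambda>M. ?G M u) \<longlonglongrightarrow> ?G_lim u"
      unfolding control_cost_def using u weak by (intro tendsto_intros endpoint) auto
    then have "limsup (\<lambda>M. ereal (?G M u)) = ereal (?G_lim u)"
      by (intro lim_imp_Limsup) auto
    with u weak show "\<exists>us. (\<forall>M\<ge>1. us M \<in> L2_ball \<rho>) \<and> L2_weakly_converges us u \<and>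
        limsup (\<lambda>M. ereal (?G M (us M))) \<le> ereal (?G_lim u)"
      by (intro exI[of _ "\<lambda>M. u"]) auto
  qed
qed

end
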